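(* Let $G$ be a connected two-directional orthogonal ray graph with given bipartition $(U,V)$ and without twins. The following are equivalent: (i) $G$ is uniquely representable; (ii) $G$ contains no buried subgraph; (iii) the auxiliary graph $G^+$ has exactly two non-trivial components (components containing at least one edge).
   Context: All graphs are finite and simple. $G$ is a bipartite graph with a fixed bipartition $(U,V)$; $N(x)$ denotes the open neighborhood of $x$. Standing assumption: $G$ has no twins, i.e. no two distinct vertices $x\neq y$ with $N(x)=N(y)$. A representation of $G$ is a pair $(<_x,<_y)$ of linear orders on $V(G)$ such that for all $u\in U$ and $v\in V$: $uv\in E(G)$ iff ($u<_x v$ and $u<_y v$). $G$ is a two-directional orthogonal ray graph if it has a representation. A representation $(<_x,<_y)$ is normalized if: (a) for all $u_1,u_2\in U$: ($u_1<_x u_2$ and $u_1<_y u_2$) iff $N(u_1)\supsetneq N(u_2)$; (b) for all $v_1,v_2\in V$: ($v_1<_x v_2$ and $v_1<_y v_2$) iff $N(v_1)\subsetneq N(v_2)$; (c) for all $u\in U$, $v\in V$: ($v<_x u$ and $v<_y u$) iff for every $v'\in N(u)$, $N(v)\subsetneq N(v')$. $G$ is uniquely representable if it has exactly two normalized representations (as pairs of linear orders). Two edges $u_1v_1$, $u_2v_2$ ($u_i\in U$, $v_i\in V$) are independent if they are disjoint and neither $u_1v_2$ nor $u_2v_1$ is an edge. A vertex set $B\subseteq V(G)$ is a buried subgraph if: (a) the induced subgraph $G[B]$ contains two independent edges; (b) each vertex of $U\setminus B$ is adjacent to all of $B\cap V$ or to none of $B\cap V$, and each vertex of $V\setminus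 B$ is adjacent to all of $B\cap U$ or to none of $B\cap U$; (c) there is at least one edge of $G-B$ that is independent (in $G$) with some other edge of $G$; (d) no vertex of $B$ is isolated in $G[B]$, and no vertex of $B$ is universal in $G[B]$ (a vertex of $B\cap U$ is universal in $G[B]$ if adjacent to all of $B\cap V$, and symmetrically for $B\cap V$). The auxiliary graph $G^+$ has vertex set $\{(a,b)\in (U\times V)\cup(V\times U): ab\notin E(G)\}$, and $(a,b)$, $(c,d)$ are adjacent in $G^+$ iff $ac\in E(G)$ and $bd\in E(G)$.
   Formalization: The formal statement additionally assumes that G contains two independent edges; without them (ii) always holds and (iii) always fails (e.g. the path on four vertices), so the equivalence is false. *)

theory Defs
  imports Main
begin

text \<open>A finite simple bipartite graph with fixed bipartition (U,V) and symmetric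
  edge predicate E; the vertex set is U \<union> V.\<close>
definition bip_graph :: "'a set \<Rightarrow> 'a set \<Rightarrow> ('a \<Rightarrow> 'a \<Rightarrow> bool) \<Rightarrow> bool" where
  "bip_graph U V E \<longleftrightarrow> finite U \<and> finite V \<and> U \<inter> V = {} \<and>
     (\<forall>x y. E x y \<longrightarrow> E y x) \<and>
     (\<forall>x y. E x y \<longrightarrow> (x \<in> U \<and> y \<in> V) \<or> (x \<in> V \<and> y \<in> U))"

definition nbhd :: "('a \<Rightarrow> 'a \<Rightarrow> bool) \<Rightarrow> 'a \<Rightarrow> 'a set" where
  "nbhd E x = {y. E x y}"

definition connected_graph :: "'a set \<Rightarrow> 'a set \<Rightarrow> ('a \<Rightarrow> 'a \<Rightarrow> bool) \<Rightarrow> bool" where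
  "connected_graph U V E \<longleftrightarrow>
     U \<union> V \<noteq> {} \<and> (\<forall>x \<in> U \<union> V. \<forall>y \<in> U \<union> V. (x, y) \<in> {(a, b). E a b}\<^sup>*)"

definition twin_free :: "'a set \<Rightarrow> 'a set \<Rightarrow> ('a \<Rightarrow> 'a \<Rightarrow> bool) \<Rightarrow> bool" where
  "twin_free U V E \<longleftrightarrow>
     (\<forall>x \<in> U \<union> V. \<forall>y \<in> U \<union> V. x \<noteq> y \<longrightarrow> nbhd E x \<noteq> nbhd E y)"

text \<open>Strict order induced by a (reflexive) linear order relation.\<close>
definition lessr :: "('a \<times> 'a) set \<Rightarrow> 'a \<Rightarrow> 'a \<Rightarrow> bool" where
  "lessr r x y \<longleftrightarrow> (x, y) \<in> r \<and> x \<noteq> y"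

definition is_rep :: "'a set \<Rightarrow> 'a set \<Rightarrow> ('a \<Rightarrow> 'a \<Rightarrow> bool) \<Rightarrow>
    ('a \<times> 'a) set \<Rightarrow> ('a \<times> 'a) set \<Rightarrow> bool" where
  "is_rep U V E rx ry \<longleftrightarrow>
     linear_order_on (U \<union> V) rx \<and> linear_order_on (U \<union> V) ry \<and>
     (\<forall>u \<in> U. \<forall>v \<in> V. E u v \<longleftrightarrow> (lessr rx u v \<and> lessr ry u v))"

definition tdorg :: "'a set \<Rightarrow> 'a set \<Rightarrow> ('a \<Rightarrow> 'a \<Rightarrow> bool) \<Rightarrow> bool" where
  "tdorg U V E \<longleftrightarrow> (\<exists>rx ry. is_rep U V E rx ry)"

definition normalized_rep :: "'a set \<Rightarrow> 'a set \<Rightarrow> ('a \<Rightarrow> 'a \<Rightarrow> bool) \<Rightarrow>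
    ('a \<times> 'a) set \<Rightarrow> ('a \<times> 'a) set \<Rightarrow> bool" where
  "normalized_rep U V E rx ry \<longleftrightarrow> is_rep U V E rx ry \<and>
     (\<forall>u1 \<in> U. \<forall>u2 \<in> U. (lessr rx u1 u2 \<and> lessr ry u1 u2) \<longleftrightarrow> nbhd E u1 \<supset> nbhd E u2) \<and>
     (\<forall>v1 \<in> V. \<forall>v2 \<in> V. (lessr rx v1 v2 \<and> lessr ry v1 v2) \<longleftrightarrow> nbhd E v1 \<subset> nbhd E v2) \<and>
     (\<forall>u \<in> U. \<forall>v \<in> V. (lessr rx v u \<and> lessr ry v u) \<longleftrightarrow>
        (\<forall>v' \<in> nbhd E u. nbhd E v \<subset> nbhd E v'))"

definition uniquely_representable :: "'a set \<Rightarrow> 'a set \<Rightarrow> ('a \<Rightarrow> 'a \<Rightarrow> bool) \<Rightarrow> bool" where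
  "uniquely_representable U V E \<longleftrightarrow> card {(rx, ry). normalized_rep U V E rx ry} = 2"

text \<open>Edges u1v1 and u2v2 (u_i in U, v_i in V) are independent.\<close>
definition indep_edges :: "'a set \<Rightarrow> 'a set \<Rightarrow> ('a \<Rightarrow> 'a \<Rightarrow> bool) \<Rightarrow> 'a \<Rightarrow> 'a \<Rightarrow> 'a \<Rightarrow> 'a \<Rightarrow> bool" where
  "indep_edges U V E u1 v1 u2 v2 \<longleftrightarrow>
     u1 \<in> U \<and> u2 \<in> U \<and> v1 \<in> V \<and> v2 \<in> V \<and> E u1 v1 \<and> E u2 v2 \<and>
     u1 \<noteq> u2 \<and> v1 \<noteq> v2 \<and> \<not> E u1 v2 \<and> \<not> E u2 v1"

definition buried :: "'a set \<Rightarrow> 'a set \<Rightarrow> ('a \<Rightarrow> 'a \<Rightarrow> bool) \<Rightarrow> 'a set \<Rightarrow> bool" where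
  "buried U V E B \<longleftrightarrow> B \<subseteq> U \<union> V \<and>
     \<comment> \<open>(a)\<close>
     (\<exists>u1 v1 u2 v2. u1 \<in> B \<and> v1 \<in> B \<and> u2 \<in> B \<and> v2 \<in> B \<and> indep_edges U V E u1 v1 u2 v2) \<and>
     \<comment> \<open>(b)\<close>
     (\<forall>u \<in> U - B. B \<inter> V \<subseteq> nbhd E u \<or> B \<inter> V \<inter> nbhd E u = {}) \<and>
     (\<forall>v \<in> V - B. B \<inter> U \<subseteq> nbhd E v \<or> B \<inter> U \<inter> nbhd E v = {}) \<and>
     \<comment> \<open>(c)\<close>
     (\<exists>u1 v1 u2 v2. u1 \<notin> B \<and> v1 \<notin> B \<and>
        (indep_edges U V E u1 v1 u2 v2 \<or> indep_edges U V E u2 v2 u1 v1)) \<and>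
     \<comment> \<open>(d)\<close>
     (\<forall>x \<in> B \<inter> U. nbhd E x \<inter> B \<noteq> {} \<and> \<not> (B \<inter> V \<subseteq> nbhd E x)) \<and>
     (\<forall>x \<in> B \<inter> V. nbhd E x \<inter> B \<noteq> {} \<and> \<not> (B \<inter> U \<subseteq> nbhd E x))"

text \<open>The auxiliary graph G^+.\<close>
definition plus_verts :: "'a set \<Rightarrow> 'a set \<Rightarrow> ('a \<Rightarrow> 'a \<Rightarrow> bool) \<Rightarrow> ('a \<times> 'a) set" where
  "plus_verts U V E = {(a, b). ((a \<in> U \<and> b \<in> V) \<or> (a \<in> V \<and> b \<in> U)) \<and> \<not> E a b}"

definition plus_adj :: "('a \<Rightarrow> 'a \<Rightarrow> bool) \<Rightarrow> 'a \<times> 'a \<Rightarrow> 'a \<times> 'a \<Rightarrow> bool" where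
  "plus_adj E p q \<longleftrightarrow> E (fst p) (fst q) \<and> E (snd p) (snd q)"

definition plus_edges :: "'a set \<Rightarrow> 'a set \<Rightarrow> ('a \<Rightarrow> 'a \<Rightarrow> bool) \<Rightarrow> (('a \<times> 'a) \<times> ('a \<times> 'a)) set" where
  "plus_edges U V E = {(p, q). p \<in> plus_verts U V E \<and> q \<in> plus_verts U V E \<and> plus_adj E p q}"

definition plus_component :: "'a set \<Rightarrow> 'a set \<Rightarrow> ('a \<Rightarrow> 'a \<Rightarrow> bool) \<Rightarrow> 'a \<times> 'a \<Rightarrow> ('a \<times> 'a) set" where
  "plus_component U V E p = {q \<in> plus_verts U V E. (p, q) \<in> (plus_edges U V E)\<^sup>*}"

definition nontrivial_plus_components :: "'a set \<Rightarrow> 'a set \<Rightarrow> ('a \<Rightarrow> 'a \<Rightarrow> bool) \<Rightarrow> ('a \<times> 'a) set set" where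
  "nontrivial_plus_components U V E =
     {C. \<exists>p \<in> plus_verts U V E. C = plus_component U V E p \<and>
         (\<exists>x \<in> C. \<exists>y \<in> C. (x, y) \<in> plus_edges U V E)}"

end

theory Submission
  imports Defs
begin

text \<open>
  The canonical partial order \<open>prec\<close> on the vertices is the intersection of the two orders of every
  normalized representation, so normalized representations correspond to transitive orientations
  of its incomparability graph. Two vertices are incomparable exactly if they lie on different
  edges of an induced 2K2. Orienting one incomparable pair forces the orientation of others, and
  the forcing classes, which arise by moving one vertex along its edge of such a 2K2, restrict to
  the nontrivial components of the auxiliary graph on the pairs in opposite parts. The components
  come in pairs of reversed orientation.

  Hence two components leave only two orientations. Conversely, the vertices touched by one
  forcing class form a module of the incomparability graph, which is buried unless it
  contains every vertex that is incomparable to some vertex; by Gallai's triangle argument two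
  different classes cannot both do so. Finally a buried subgraph is a module of the order: collapsing
  it to a point and reinserting it with its two orders exchanged gives a third representation.
\<close>

section \<open>Induced 2K2s, incomparability, the canonical order and forcing\<close>

definition ind_2K2 :: "('a \<Rightarrow> 'a \<Rightarrow> bool) \<Rightarrow> 'a \<Rightarrow> 'a \<Rightarrow> 'a \<Rightarrow> 'a \<Rightarrow> bool" where
  "ind_2K2 E a c b d \<longleftrightarrow> E a c \<and> E b d \<and> \<not> E a b \<and> \<not> E a d \<and> \<not> E c b \<and> \<not> E c d"

definition inc :: "('a \<Rightarrow> 'a \<Rightarrow> bool) \<Rightarrow> 'a \<Rightarrow> 'a \<Rightarrow> bool" where
  "inc E a b \<longleftrightarrow> (\<exists>c d. ind_2K2 E a c b d)"

text \<open>There is one clause for each choice of parts, matching the representation condition and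
  conditions (a) to (c) of normalization. The last clause is condition (c) in the absence of twins:
  joined neighbourhoods give the inclusions, and non-adjacency makes them strict.\<close>

definition prec :: "'a set \<Rightarrow> 'a set \<Rightarrow> ('a \<Rightarrow> 'a \<Rightarrow> bool) \<Rightarrow> 'a \<Rightarrow> 'a \<Rightarrow> bool" where
  "prec U V E x y \<longleftrightarrow>
     x \<in> U \<and> y \<in> U \<and> nbhd E y \<subset> nbhd E x \<or>
     x \<in> V \<and> y \<in> V \<and> nbhd E x \<subset> nbhd E y \<or>
     x \<in> U \<and> y \<in> V \<and> E x y \<or>
     x \<in> V \<and> y \<in> U \<and> \<not> E x y \<and> (\<forall>x'. E x x' \<longrightarrow> (\<forall>y'. E y y' \<longrightarrow> E x' y'))"

text \<open>Every representation keeps two independent edges apart in each order, so moving one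
  vertex of a pair along its own edge preserves the orientation of the pair. Pairs are ordered: a
  chain from \<open>a b\<close> to \<open>b a\<close> rules out every representation.\<close>

inductive forces :: "('a \<Rightarrow> 'a \<Rightarrow> bool) \<Rightarrow> 'a \<Rightarrow> 'a \<Rightarrow> 'a \<Rightarrow> 'a \<Rightarrow> bool"
  for E a b where
  refl: "inc E a b \<Longrightarrow> forces E a b a b"
| left: "forces E a b p q \<Longrightarrow> ind_2K2 E p c q d \<Longrightarrow> forces E a b c q"
| right: "forces E a b p q \<Longrightarrow> ind_2K2 E p c q d \<Longrightarrow> forces E a b p d"

lemma ind_2K2_inc: "ind_2K2 E a c b d \<Longrightarrow> inc E a b"
  by (auto simp: inc_def)

lemma forces_trans: "forces E p q r s \<Longrightarrow> forces E a b p q \<Longrightarrow> forces E a b r s"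
  by (induction rule: forces.induct) (auto intro: forces.intros)

locale bigraph =
  fixes U V :: "'a set" and E :: "'a \<Rightarrow> 'a \<Rightarrow> bool"
  assumes bip: "bip_graph U V E"
begin

lemma E_sym: "E x y \<longleftrightarrow> E y x"
  using bip by (auto simp: bip_graph_def)

lemma disj: "x \<in> U \<Longrightarrow> x \<in> V \<Longrightarrow> False"
  using bip by (auto simp: bip_graph_def)

lemma E_mem: "E x y \<Longrightarrow> x \<in> U \<union> V \<and> y \<in> U \<union> V"
  using bip by (auto simp: bip_graph_def)

lemma E_side: "E x y \<Longrightarrow> x \<in> U \<longleftrightarrow> y \<notin> U"
  using bip unfolding bip_graph_def by blast

lemma E_side': "E x y \<Longrightarrow> x \<in> V \<longleftrightarrow> y \<notin> V"
  using bip unfolding bip_graph_def by blast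

text \<open>All four cross pairs are excluded, including the two inside a part; this makes the
  endpoints interchangeable without reference to \<open>U\<close> and \<open>V\<close>.\<close>

lemma ind_2K2_sym:
  "ind_2K2 E a c b d \<Longrightarrow> ind_2K2 E b d a c"
  "ind_2K2 E a c b d \<Longrightarrow> ind_2K2 E c a b d"
  "ind_2K2 E a c b d \<Longrightarrow> ind_2K2 E a c d b"
  using E_sym by (auto simp: ind_2K2_def)

lemma inc_sym: "inc E a b \<longleftrightarrow> inc E b a"
  using ind_2K2_sym by (metis inc_def)

lemma inc_irrefl: "\<not> inc E a a"
  by (auto simp: inc_def ind_2K2_def)

lemma E_not_inc: "E a b \<Longrightarrow> \<not> inc E a b"
  by (auto simp: inc_def ind_2K2_def)

lemma inc_mem: "inc E a b \<Longrightarrow> a \<in> U \<union> V \<and> b \<in> U \<union> V"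
  using E_mem by (auto simp: inc_def ind_2K2_def)

lemma forces_inc: "forces E a b p q \<Longrightarrow> inc E p q \<and> inc E a b"
  by (induction rule: forces.induct) (auto intro: ind_2K2_inc ind_2K2_sym)

lemma forces_sym: "forces E a b p q \<Longrightarrow> forces E p q a b"
proof (induction rule: forces.induct)
  case refl then show ?case by (rule forces.refl)
next
  case (left p q c d)
  have i: "ind_2K2 E c p q d" using left ind_2K2_sym by blast
  show ?case
    by (rule forces_trans[OF left.IH]) (rule forces.left[OF forces.refl i], rule ind_2K2_inc[OF i])
next
  case (right p q c d)
  have i: "ind_2K2 E p c d q" using right ind_2K2_sym by blast
  show ?case
    by (rule forces_trans[OF right.IH]) (rule forces.right[OF forces.refl i], rule ind_2K2_inc[OF i])
qed

lemma forces_swap: "forces E a b p q \<Longrightarrow> forces E b a q p"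
proof (induction rule: forces.induct)
  case refl then show ?case using inc_sym forces.refl by metis
next
  case (left p q c d)
  then show ?case using forces.right ind_2K2_sym by metis
next
  case (right p q c d)
  then show ?case using forces.left ind_2K2_sym by metis
qed

lemma ind_2K2_forces:
  assumes "ind_2K2 E a c b d"
  shows "forces E a b a b" "forces E a b c b" "forces E a b a d" "forces E a b c d"
proof -
  show 1: "forces E a b a b" using assms by (intro forces.refl ind_2K2_inc)
  show 2: "forces E a b c b" by (rule forces.left[OF 1 assms])
  show 3: "forces E a b a d" by (rule forces.right[OF 1 assms])
  show "forces E a b c d" by (rule forces.right[OF 2]) (use assms ind_2K2_sym in blast)
qed

section \<open>Forcing between incomparable pairs with a common vertex\<close>

lemma nbhd_chain_if_not_inc:
  assumes "b \<in> U \<longleftrightarrow> b' \<in> U" "\<not> inc E b b'"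
  shows "nbhd E b \<subseteq> nbhd E b' \<or> nbhd E b' \<subseteq> nbhd E b"
proof (rule ccontr)
  assume "\<not> ?thesis"
  then obtain x y where "E b x" "\<not> E b' x" "E b' y" "\<not> E b y"
    by (auto simp: nbhd_def)
  then have "ind_2K2 E b x b' y"
    unfolding ind_2K2_def using assms(1) E_side E_sym by metis
  then show False using assms(2) ind_2K2_inc by fast
qed

text \<open>If \<open>x y\<close> were missing, \<open>b x\<close> and \<open>b' y\<close> would be
  an induced 2K2, as \<open>b y\<close> and \<open>x b'\<close> lie inside a part.\<close>

lemma nbhds_joined_if_not_inc:
  assumes "\<not> (b \<in> U \<longleftrightarrow> b' \<in> U)" "\<not> inc E b b'" "\<not> E b b'" "E b x" "E b' y"
  shows "E x y"
proof (rule ccontr)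
  assume "\<not> E x y"
  then have "ind_2K2 E b x b' y"
    using assms E_side[of b x] E_side[of b' y] E_side[of b y] E_side[of x b']
    by (auto simp: ind_2K2_def)
  then show False using assms(2) ind_2K2_inc by fast
qed

text \<open>\<open>d\<close> is also a neighbour of \<open>b'\<close>, so \<open>b d\<close> and
  \<open>b' d\<close> lead from \<open>b\<close> to \<open>b'\<close> once a single edge at
  \<open>a\<close> is independent of both. The edge \<open>a c\<close> serves unless
  \<open>c\<close> is adjacent to \<open>b'\<close>; then \<open>a c'\<close> does.\<close>

lemma forces_same_side:
  assumes ab: "ind_2K2 E a c b d" and ab': "ind_2K2 E a c' b' d'"
    and s: "b \<in> U \<longleftrightarrow> b' \<in> U" and sub: "nbhd E b \<subseteq> nbhd E b'"
  shows "forces E a b a b'"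
proof -
  obtain e where "ind_2K2 E a e b d" "ind_2K2 E a e b' d"
  proof (cases "E c b'")
    case True
    have "\<not> E c' b" using ab' sub E_sym[of c' b] E_sym[of c' b'] by (auto simp: ind_2K2_def nbhd_def)
    moreover have "E b' d" using ab sub by (auto simp: ind_2K2_def nbhd_def)
    moreover have "\<not> E c' d"
      using ab ab' s True E_side[of c b'] E_side[of a c] E_side[of a c'] E_side[of b d] E_side[of c' d]
      by (auto simp: ind_2K2_def)
    ultimately have "ind_2K2 E a c' b d" "ind_2K2 E a c' b' d"
      using ab ab' by (auto simp: ind_2K2_def)
    then show ?thesis using that by blast
  next
    case False
    then have "ind_2K2 E a c b' d"
      using ab ab' sub by (auto simp: ind_2K2_def nbhd_def)
    then show ?thesis using that ab by blast
  qed
  then show ?thesis using ind_2K2_forces forces_sym forces_trans by meson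
qed

text \<open>The route is \<open>b\<close>, \<open>d\<close>, \<open>d'\<close>, \<open>b'\<close>:
  the edge \<open>d d'\<close> exists because the neighbourhoods are joined, and \<open>a c'\<close>
  is independent of it.\<close>

lemma forces_other_side:
  assumes ab: "ind_2K2 E a c b d" and ab': "ind_2K2 E a c' b' d'"
    and s: "b \<in> U \<longleftrightarrow> b' \<notin> U" and a: "a \<in> U \<longleftrightarrow> b \<in> U"
    and j: "\<And>x y. E b x \<Longrightarrow> E b' y \<Longrightarrow> E x y"
  shows "forces E a b a b'"
proof -
  have "ind_2K2 E a c' d' d"
    using ab ab' s a j[of d d'] E_side E_sym unfolding ind_2K2_def by metis
  then show ?thesis using ab ab' ind_2K2_forces forces_sym forces_trans ind_2K2_sym by metis
qed

text \<open>The edge \<open>b b'\<close> itself is independent of \<open>a c\<close> or else of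
  \<open>a c'\<close>.\<close>

lemma forces_adjacent:
  assumes ab: "ind_2K2 E a c b d" and ab': "ind_2K2 E a c' b' d'" and e: "E b b'"
  shows "forces E a b a b'"
proof (cases "E c b'")
  case True
  then have "ind_2K2 E a c' b' b"
    using ab ab' e E_side[of c b'] E_side[of a c] E_side[of a c'] E_side[of b b'] E_side[of c' b]
      E_sym[of b b'] by (auto simp: ind_2K2_def)
  then show ?thesis using ind_2K2_forces forces_sym by metis
next
  case False
  then have "ind_2K2 E a c b b'"
    using ab ab' e by (auto simp: ind_2K2_def)
  then show ?thesis using ind_2K2_forces by metis
qed

text \<open>Gallai's forcing rule for transitive orientations is thus generated by the 2K2 moves.
  The cases are \<open>b\<close>, \<open>b'\<close> in one part with nested neighbourhoods,
  adjacent, or non-adjacent across the parts with joined neighbourhoods.\<close>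

lemma forces_if_not_inc:
  assumes ab: "inc E a b" and ab': "inc E a b'" and n: "\<not> inc E b b'"
  shows "forces E a b a b'"
proof -
  obtain c d where 1: "ind_2K2 E a c b d" using ab by (auto simp: inc_def)
  obtain c' d' where 2: "ind_2K2 E a c' b' d'" using ab' by (auto simp: inc_def)
  show ?thesis
  proof (cases "b \<in> U \<longleftrightarrow> b' \<in> U")
    case True
    then show ?thesis
      using nbhd_chain_if_not_inc[OF True n] forces_same_side[OF 1 2] forces_same_side[OF 2 1]
        forces_sym by blast
  next
    case s: False
    show ?thesis
    proof (cases "E b b'")
      case True
      then show ?thesis by (rule forces_adjacent[OF 1 2])
    next
      case False
      note j = nbhds_joined_if_not_inc[OF s n False]
      show ?thesis
      proof (cases "a \<in> U \<longleftrightarrow> b \<in> U")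
        case True
        then show ?thesis using forces_other_side[OF 1 2 _ True] s j by blast
      next
        \<comment> \<open>Here \<open>a\<close> shares its part with \<open>b'\<close>, so
          \<open>b\<close> and \<open>b'\<close> exchange roles.\<close>
        case False
        then have "forces E a b' a b"
          using forces_other_side[OF 2 1] s j E_sym by blast
        then show ?thesis by (rule forces_sym)
      qed
    qed
  qed
qed

section \<open>Forcing classes up to reversal, their spans and the triangle argument\<close>

definition linked :: "'a \<Rightarrow> 'a \<Rightarrow> 'a \<Rightarrow> 'a \<Rightarrow> bool" where
  "linked a b c d \<longleftrightarrow> forces E a b c d \<or> forces E a b d c"

lemma linked_sym: "linked a b c d \<Longrightarrow> linked c d a b"
  unfolding linked_def using forces_sym forces_swap by blast

lemma linked_trans: "linked a b c d \<Longrightarrow> linked c d e f \<Longrightarrow> linked a b e f"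
  unfolding linked_def using forces_trans forces_swap by meson

lemma linked_swap: "linked a b c d \<longleftrightarrow> linked b a c d" "linked a b c d \<longleftrightarrow> linked a b d c"
  unfolding linked_def using forces_swap by blast+

lemma linked_refl: "inc E a b \<Longrightarrow> linked a b a b"
  by (simp add: linked_def forces.refl)

lemma linked_inc: "linked a b c d \<Longrightarrow> inc E a b \<and> inc E c d"
  unfolding linked_def using forces_inc inc_sym by blast

lemma linked_if_not_inc:
  "inc E a b \<Longrightarrow> inc E a b' \<Longrightarrow> \<not> inc E b b' \<Longrightarrow> linked a b a b'"
  unfolding linked_def using forces_if_not_inc by blast

definition span :: "'a \<Rightarrow> 'a \<Rightarrow> 'a set" where
  "span a b = {x. \<exists>y. linked a b x y}"

text \<open>In a triangle of incomparable pairs whose side \<open>b c\<close> differs in class from the other two sides,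
  \<open>b c\<close> can be forced around without ever reaching the apex \<open>a\<close>.\<close>
lemma triangle_forces:
  assumes "forces E b c p q"
    and ab: "inc E a b" and ac: "inc E a c"
    and n1: "\<not> linked b c a b" and n2: "\<not> linked b c a c"
  shows "linked a b a p \<and> linked a c a q"
  using assms(1)
proof (induction rule: forces.induct)
  case refl
  then show ?case using ab ac linked_refl by blast
next
  case (left p q p' d)
  note i = left.hyps(2)
  have pp: "\<not> inc E p p'" using i E_not_inc by (auto simp: ind_2K2_def)
  have bc: "linked b c p' q" using forces.left[OF left.hyps] by (auto simp: linked_def)
  have inc: "inc E a p" "inc E a q" "inc E q p'"
    using left.IH linked_inc bc inc_sym by metis+
  \<comment> \<open>Otherwise \<open>q a\<close> and \<open>q p'\<close> are linked, so
    \<open>b c\<close> reaches \<open>a q\<close> and with it \<open>a c\<close>.\<close>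
  have "inc E a p'"
  proof (rule ccontr)
    assume "\<not> inc E a p'"
    then have "linked q a q p'"
      using inc inc_sym by (intro linked_if_not_inc) metis+
    then have "linked b c a q" using bc linked_sym linked_trans linked_swap by metis
    then show False using n2 left.IH linked_sym linked_trans by metis
  qed
  then have "linked a p a p'" using linked_if_not_inc inc pp by blast
  then show ?case using left.IH linked_trans by metis
next
  case (right p q d q')
  note i = right.hyps(2)
  have qq: "\<not> inc E q q'" using i E_not_inc by (auto simp: ind_2K2_def)
  have bc: "linked b c p q'" using forces.right[OF right.hyps] by (auto simp: linked_def)
  have inc: "inc E a p" "inc E a q" "inc E p q'"
    using right.IH linked_inc bc inc_sym by metis+
  have "inc E a q'"
  proof (rule ccontr)
    assume "\<not> inc E a q'"
    then have "linked p a p q'"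
      using inc inc_sym by (intro linked_if_not_inc) metis+
    then have "linked b c a p" using bc linked_sym linked_trans linked_swap by metis
    then show False using n1 right.IH linked_sym linked_trans by metis
  qed
  then have "linked a q a q'" using linked_if_not_inc inc qq by blast
  then show ?case using right.IH linked_trans by metis
qed

text \<open>If \<open>b c\<close> differed in class from both other sides, forcing it around to a
  pair containing \<open>a\<close> would make \<open>a\<close> incomparable to itself.\<close>

lemma triangle:
  assumes "inc E a b" "inc E a c" "a \<in> span b c"
  shows "linked b c a b \<or> linked b c a c"
proof (rule ccontr)
  assume n: "\<not> ?thesis"
  obtain y where "linked b c a y" using assms by (auto simp: span_def)
  then have "forces E b c a y \<or> forces E b c y a" by (simp add: linked_def)
  then have "linked a b a a \<or> linked a c a a"
    using triangle_forces[OF _ assms(1,2)] n by blast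
  then show False using linked_inc inc_irrefl by blast
qed

text \<open>Two classes that both reach \<open>a\<close> contain sides \<open>a b\<close> and
  \<open>a c\<close> of a triangle of incomparable pairs, in which every apex lies in the span of
  the opposite side.\<close>

lemma linked_if_same_span:
  assumes sp: "\<And>p q x y. inc E p q \<Longrightarrow> inc E x y \<Longrightarrow> x \<in> span p q"
    and inc: "inc E a b" "inc E p q"
  shows "linked a b p q"
proof (rule ccontr)
  assume n: "\<not> linked a b p q"
  obtain c where c: "linked p q a c" using sp[OF inc(2,1)] by (auto simp: span_def)
  have n: "\<not> linked a b a c" using n c linked_sym linked_trans by metis
  have ac: "inc E a c" using c linked_inc by blast
  have bc: "inc E b c" using n linked_if_not_inc[OF inc(1) ac] by blast
  \<comment> \<open>Each of the three sides is linked to another one, so all three are in one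
    class.\<close>
  have "linked b c a b \<or> linked b c a c"
    by (rule triangle) (use sp inc ac bc in blast)+
  moreover have "linked a c b a \<or> linked a c b c"
    by (rule triangle) (use sp inc ac bc inc_sym in blast)+
  moreover have "linked a b c a \<or> linked a b c b"
    by (rule triangle) (use sp inc ac bc inc_sym in blast)+
  ultimately show False
    using n linked_swap linked_sym linked_trans by metis
qed

text \<open>Consecutive pairs of a forcing chain share a vertex, so the linked pairs connect the
  whole span.\<close>

lemma span_connected:
  assumes step: "\<And>x y. linked a b x y \<Longrightarrow> \<phi> x \<longleftrightarrow> \<phi> y"
    and x: "x \<in> span a b" and y: "y \<in> span a b"
  shows "\<phi> x \<longleftrightarrow> \<phi> y"
proof -
  have *: "\<phi> p \<longleftrightarrow> \<phi> a" if "forces E a b p q" for p q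
    using that
  proof (induction rule: forces.induct)
    case (left p q c d)
    have "linked a b p q" "linked a b c q"
      using left.hyps forces.left by (auto simp: linked_def)
    then show ?case using step left.IH by blast
  qed simp_all
  have "\<phi> x \<longleftrightarrow> \<phi> a" if "linked a b x y" for x y
    using that * step by (metis linked_def)
  then show ?thesis using x y unfolding span_def by blast
qed

text \<open>If \<open>x\<close> were incomparable to only one end \<open>r\<close> of a pair
  \<open>r r'\<close> of the class, then \<open>r x\<close> would be forced into the class and
  \<open>x\<close> into the span.\<close>

lemma span_module:
  assumes x: "x \<notin> span a b" and p: "p \<in> span a b" and q: "q \<in> span a b" and i: "inc E x p"
  shows "inc E x q"
proof -
  have *: "inc E x r'" if l: "linked a b r r'" and i: "inc E x r" for r r'
  proof (rule ccontr)
    assume n: "\<not> inc E x r'"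
    have "linked r r' r x"
      using linked_if_not_inc[of r r' x] n i l linked_inc inc_sym by blast
    then have "linked a b x r" using l linked_trans linked_swap by metis
    then show False using x by (auto simp: span_def)
  qed
  have "inc E x r \<longleftrightarrow> inc E x r'" if "linked a b r r'" for r r'
    using * that linked_swap by blast
  then show ?thesis using span_connected[of a b "inc E x" p q] p q i by blast
qed

section \<open>Independent edges and the canonical partial order\<close>

lemma ind_2K2_indep_edges:
  assumes "ind_2K2 E a c b d"
  obtains u1 v1 u2 v2 where "indep_edges U V E u1 v1 u2 v2" "{u1, v1} = {a, c}" "{u2, v2} = {b, d}"
    "ind_2K2 E u1 v1 u2 v2"
proof -
  have e: "E a c" "E b d" using assms by (auto simp: ind_2K2_def)
  obtain u1 v1 where 1: "u1 \<in> U" "v1 \<in> V" "u1 = a \<and> v1 = c \<or> u1 = c \<and> v1 = a"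
    using e(1) E_mem E_side by blast
  obtain u2 v2 where 2: "u2 \<in> U" "v2 \<in> V" "u2 = b \<and> v2 = d \<or> u2 = d \<and> v2 = b"
    using e(2) E_mem E_side by blast
  have i: "ind_2K2 E u1 v1 u2 v2" using assms 1(3) 2(3) ind_2K2_sym by metis
  moreover from i have "indep_edges U V E u1 v1 u2 v2"
    using 1 2 E_sym by (auto simp: ind_2K2_def indep_edges_def)
  ultimately show thesis using that 1(3) 2(3) by blast
qed

lemma indep_edges_ind_2K2:
  assumes "indep_edges U V E u1 v1 u2 v2"
  shows "ind_2K2 E u1 v1 u2 v2"
  using assms E_side[of u1 u2] E_side'[of v1 v2] E_sym by (auto simp: indep_edges_def ind_2K2_def)

text \<open>Exchanging the parts reverses the order; this transfers facts about vertices of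
  \<open>U\<close> to vertices of \<open>V\<close>.\<close>

lemma prec_dual: "prec V U E x y \<longleftrightarrow> prec U V E y x"
  unfolding prec_def using E_sym by blast

lemma prec_UV [simp]: "u \<in> U \<Longrightarrow> v \<in> V \<Longrightarrow> prec U V E u v \<longleftrightarrow> E u v"
  using disj by (auto simp: prec_def)

lemma prec_VU [simp]:
  "u \<in> U \<Longrightarrow> v \<in> V \<Longrightarrow> prec U V E v u \<longleftrightarrow>
    \<not> E u v \<and> (\<forall>x y. E v x \<longrightarrow> E u y \<longrightarrow> E x y)"
  using disj E_sym by (auto simp: prec_def)

lemma prec_UU [simp]:
  "u \<in> U \<Longrightarrow> u' \<in> U \<Longrightarrow> prec U V E u u' \<longleftrightarrow> nbhd E u' \<subset> nbhd E u"
  using disj by (auto simp: prec_def)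

lemma prec_VV [simp]:
  "v \<in> V \<Longrightarrow> v' \<in> V \<Longrightarrow> prec U V E v v' \<longleftrightarrow> nbhd E v \<subset> nbhd E v'"
  using disj by (auto simp: prec_def)

lemma prec_mem: "prec U V E x y \<Longrightarrow> x \<in> U \<union> V \<and> y \<in> U \<union> V"
  by (auto simp: prec_def)

lemma prec_irrefl: "\<not> prec U V E x x"
  using disj by (auto simp: prec_def)

lemma prec_not_inc:
  assumes "prec U V E x y"
  shows "\<not> inc E x y"
proof
  assume "inc E x y"
  then obtain c d where "ind_2K2 E x c y d" by (auto simp: inc_def)
  then show False using assms E_sym[of c y] by (auto simp: prec_def ind_2K2_def nbhd_def)
qed

lemma prec_trans:
  assumes xy: "prec U V E x y" and yz: "prec U V E y z"
  shows "prec U V E x z"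
proof -
  have m: "x \<in> U \<union> V" "y \<in> U \<union> V" "z \<in> U \<union> V" using prec_mem assms by blast+
  consider "x \<in> U" "y \<in> U" "z \<in> U" | "x \<in> U" "y \<in> U" "z \<in> V"
    | "x \<in> U" "y \<in> V" "z \<in> U" | "x \<in> U" "y \<in> V" "z \<in> V"
    | "x \<in> V" "y \<in> U" "z \<in> U" | "x \<in> V" "y \<in> U" "z \<in> V"
    | "x \<in> V" "y \<in> V" "z \<in> U" | "x \<in> V" "y \<in> V" "z \<in> V"
    using m by blast
  then show ?thesis
  proof cases
    case 1 then show ?thesis using assms by auto
  next
    case 2
    then have "E y z" "nbhd E y \<subset> nbhd E x" using assms by simp_all
    then show ?thesis using 2 by (auto simp: nbhd_def)
  next
    case 3
    then have "E x y" "\<not> E z y" and j: "\<And>p q. E y p \<Longrightarrow> E z q \<Longrightarrow> E p q" using assms by simp_all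
    \<comment> \<open>The middle vertex \<open>y\<close> witnesses that the inclusion is
      strict.\<close>
    then have "y \<in> nbhd E x" "y \<notin> nbhd E z" "nbhd E z \<subseteq> nbhd E x"
      using j[of x] E_sym[of x y] by (auto simp: nbhd_def)
    then show ?thesis using 3 by auto
  next
    case 4
    then have "E x y" "nbhd E y \<subset> nbhd E z" using assms by simp_all
    then show ?thesis using 4 E_sym[of x y] E_sym[of x z] by (auto simp: nbhd_def)
  next
    case 5
    then have "\<not> E y x" "\<And>p q. E x p \<Longrightarrow> E y q \<Longrightarrow> E p q" "nbhd E z \<subset> nbhd E y"
      using assms by simp_all
    then show ?thesis using 5 by (auto simp: nbhd_def)
  next
    case 6
    then have "E y z" "\<not> E y x" and j: "\<And>p q. E x p \<Longrightarrow> E y q \<Longrightarrow> E p q" using assms by simp_all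
    then have "y \<in> nbhd E z" "y \<notin> nbhd E x" "nbhd E x \<subseteq> nbhd E z"
      using j[of _ z] E_sym by (auto simp: nbhd_def)
    then show ?thesis using 6 by auto
  next
    case 7
    then have "\<not> E z y" "\<And>p q. E y p \<Longrightarrow> E z q \<Longrightarrow> E p q" "nbhd E x \<subset> nbhd E y"
      using assms by simp_all
    then show ?thesis using 7 E_sym[of z x] E_sym[of z y] by (auto simp: nbhd_def)
  next
    case 8 then show ?thesis using assms by auto
  qed
qed

lemma prec_asym: "prec U V E x y \<Longrightarrow> \<not> prec U V E y x"
  using prec_trans prec_irrefl by blast

end

locale twin_free_bigraph = bigraph +
  assumes tf: "twin_free U V E"
begin

lemma dual: "twin_free_bigraph V U E"
  using bip tf unfolding twin_free_bigraph_def twin_free_bigraph_axioms_def bigraph_def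
    bip_graph_def twin_free_def by blast

lemma nbhd_inj: "x \<in> U \<union> V \<Longrightarrow> y \<in> U \<union> V \<Longrightarrow> nbhd E x = nbhd E y \<Longrightarrow> x = y"
  using tf unfolding twin_free_def by blast

text \<open>Within a part, vertices that are not incomparable have nested neighbourhoods, strictly
  nested in the absence of twins. Across the parts, non-adjacent ones have joined
  neighbourhoods.\<close>

lemma prec_trichotomy:
  assumes "x \<in> U \<union> V" "y \<in> U \<union> V"
  shows "x = y \<or> prec U V E x y \<or> prec U V E y x \<or> inc E x y"
proof -
  have *: "E u v \<or> prec U V E v u \<or> inc E u v" if "u \<in> U" "v \<in> V" for u v
    using that nbhds_joined_if_not_inc[of v u] disj[of v] E_sym inc_sym by auto
  have same: "x = y \<or> nbhd E x \<subset> nbhd E y \<or> nbhd E y \<subset> nbhd E x \<or> inc E x y"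
    if "x \<in> U \<longleftrightarrow> y \<in> U"
    using that assms nbhd_inj[of x y] nbhd_chain_if_not_inc[of x y] by blast
  consider "x \<in> U" "y \<in> U" | "x \<in> V" "y \<in> V" | "x \<in> U" "y \<in> V" | "x \<in> V" "y \<in> U"
    using assms by blast
  then show ?thesis
  proof cases
    case 1 then show ?thesis using same by auto
  next
    case 2 then show ?thesis using same disj by auto
  next
    case 3 then show ?thesis using *[of x y] by auto
  next
    case 4 then show ?thesis using *[of y x] inc_sym prec_UV by blast
  qed
qed

lemma normalized_rep_iff:
  "normalized_rep U V E rx ry \<longleftrightarrow>
     linear_order_on (U \<union> V) rx \<and> linear_order_on (U \<union> V) ry \<and>
     (\<forall>x \<in> U \<union> V. \<forall>y \<in> U \<union> V. lessr rx x y \<and> lessr ry x y \<longleftrightarrow> prec U V E x y)"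
proof -
  \<comment> \<open>Joined neighbourhoods amount to the inclusions. These are strict because equal
    neighbourhoods would give \<open>v = v'\<close> and hence an edge \<open>u v\<close>.\<close>
  have c: "(\<forall>v' \<in> nbhd E u. nbhd E v \<subset> nbhd E v') \<longleftrightarrow> prec U V E v u" if "u \<in> U" "v \<in> V" for u v
  proof
    assume "\<forall>v' \<in> nbhd E u. nbhd E v \<subset> nbhd E v'"
    then show "prec U V E v u" using that E_sym by (auto simp: nbhd_def)
  next
    assume p: "prec U V E v u"
    have "nbhd E v \<subset> nbhd E v'" if v': "E u v'" for v'
    proof -
      have "nbhd E v \<subseteq> nbhd E v'" using p v' that \<open>u \<in> U\<close> \<open>v \<in> V\<close> E_sym by (auto simp: nbhd_def)
      moreover have "nbhd E v \<noteq> nbhd E v'"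
        using p v' that \<open>u \<in> U\<close> \<open>v \<in> V\<close> nbhd_inj[of v v'] E_mem[of u v'] by auto
      ultimately show ?thesis by blast
    qed
    then show "\<forall>v' \<in> nbhd E u. nbhd E v \<subset> nbhd E v'" by (simp add: nbhd_def)
  qed
  have q: "(\<forall>x \<in> U \<union> V. \<forall>y \<in> U \<union> V. Q x y) \<longleftrightarrow> (\<forall>u \<in> U. \<forall>v \<in> V. Q u v) \<and>
      (\<forall>u \<in> U. \<forall>u' \<in> U. Q u u') \<and> (\<forall>v \<in> V. \<forall>v' \<in> V. Q v v') \<and> (\<forall>u \<in> U. \<forall>v \<in> V. Q v u)" for Q
    by blast
  let ?less = "\<lambda>x y. lessr rx x y \<and> lessr ry x y"
  have UV: "(\<forall>u \<in> U. \<forall>v \<in> V. E u v \<longleftrightarrow> ?less u v) \<longleftrightarrow>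
      (\<forall>u \<in> U. \<forall>v \<in> V. ?less u v \<longleftrightarrow> prec U V E u v)"
    by (simp cong: ball_cong) blast
  have UU: "(\<forall>u \<in> U. \<forall>u' \<in> U. ?less u u' \<longleftrightarrow> nbhd E u \<supset> nbhd E u') \<longleftrightarrow>
      (\<forall>u \<in> U. \<forall>u' \<in> U. ?less u u' \<longleftrightarrow> prec U V E u u')"
    by (simp cong: ball_cong)
  have VV: "(\<forall>v \<in> V. \<forall>v' \<in> V. ?less v v' \<longleftrightarrow> nbhd E v \<subset> nbhd E v') \<longleftrightarrow>
      (\<forall>v \<in> V. \<forall>v' \<in> V. ?less v v' \<longleftrightarrow> prec U V E v v')"
    by (simp cong: ball_cong)
  have VU: "(\<forall>u \<in> U. \<forall>v \<in> V. ?less v u \<longleftrightarrow> (\<forall>v' \<in> nbhd E u. nbhd E v \<subset> nbhd E v')) \<longleftrightarrow>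
      (\<forall>u \<in> U. \<forall>v \<in> V. ?less v u \<longleftrightarrow> prec U V E v u)"
    by (simp only: c cong: ball_cong)
  show ?thesis
    unfolding normalized_rep_def is_rep_def q UV UU VV VU by blast
qed

end

section \<open>Linear orders and the position of independent edges in a representation\<close>

lemma linear_order_on_iff:
  "linear_order_on A r \<longleftrightarrow> r \<subseteq> A \<times> A \<and> (\<forall>x \<in> A. (x, x) \<in> r) \<and>
     (\<forall>x y z. (x, y) \<in> r \<longrightarrow> (y, z) \<in> r \<longrightarrow> (x, z) \<in> r) \<and>
     (\<forall>x y. (x, y) \<in> r \<longrightarrow> (y, x) \<in> r \<longrightarrow> x = y) \<and>
     (\<forall>x \<in> A. \<forall>y \<in> A. (x, y) \<in> r \<or> (y, x) \<in> r)"
proof -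
  have "total_on A r \<longleftrightarrow> (\<forall>x \<in> A. \<forall>y \<in> A. (x, y) \<in> r \<or> (y, x) \<in> r)" if "\<forall>x \<in> A. (x, x) \<in> r"
    using that unfolding total_on_def by metis
  then show ?thesis unfolding order_on_defs refl_on_def trans_def antisym_def by meson
qed

lemma lessr_trans:
  "linear_order_on A r \<Longrightarrow> lessr r x y \<Longrightarrow> lessr r y z \<Longrightarrow> lessr r x z"
  unfolding linear_order_on_iff lessr_def by metis

lemma lessr_asym: "linear_order_on A r \<Longrightarrow> lessr r x y \<Longrightarrow> \<not> lessr r y x"
  unfolding linear_order_on_iff lessr_def by metis

lemma lessr_total:
  "linear_order_on A r \<Longrightarrow> x \<in> A \<Longrightarrow> y \<in> A \<Longrightarrow> x \<noteq> y \<Longrightarrow> lessr r x y \<longleftrightarrow> \<not> lessr r y x"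
  unfolding linear_order_on_iff lessr_def by metis

definition before :: "('a \<times> 'a) set \<Rightarrow> 'a \<Rightarrow> 'a \<Rightarrow> 'a \<Rightarrow> 'a \<Rightarrow> bool" where
  "before r a c b d \<longleftrightarrow> lessr r a b \<and> lessr r a d \<and> lessr r c b \<and> lessr r c d"

context bigraph
begin

text \<open>The first order reads \<open>u2\<close>, \<open>v2\<close>, \<open>u1\<close>,
  \<open>v1\<close>. There \<open>u2\<close> precedes \<open>v1\<close>, so the non-edge
  \<open>u2 v1\<close> is due to the second order, which must read \<open>u1\<close>,
  \<open>v1\<close>, \<open>u2\<close>, \<open>v2\<close>.\<close>

lemma rep_separates_edges_left:
  assumes rep: "is_rep U V E rx ry" and m: "u1 \<in> U" "v1 \<in> V" "u2 \<in> U" "v2 \<in> V"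
    and i: "ind_2K2 E u1 v1 u2 v2" and l: "lessr rx v2 u1"
  shows "before rx u2 v2 u1 v1 \<and> before ry u1 v1 u2 v2"
proof -
  have lin: "linear_order_on (U \<union> V) rx" "linear_order_on (U \<union> V) ry"
    and e: "\<And>u v. u \<in> U \<Longrightarrow> v \<in> V \<Longrightarrow> E u v \<longleftrightarrow> lessr rx u v \<and> lessr ry u v"
    using rep by (auto simp: is_rep_def)
  have 1: "lessr rx u1 v1" "lessr ry u1 v1" "lessr rx u2 v2" "lessr ry u2 v2" "\<not> E u2 v1"
    using i e m E_sym by (auto simp: ind_2K2_def)
  have 2: "before rx u2 v2 u1 v1"
    using 1 l lessr_trans[OF lin(1)] unfolding before_def by blast
  then have "\<not> lessr ry u2 v1" using 1 e m by (auto simp: before_def)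
  then have "lessr ry v1 u2" using lessr_total[OF lin(2), of v1 u2] m disj by blast
  then have "before ry u1 v1 u2 v2"
    using 1 lessr_trans[OF lin(2)] unfolding before_def by blast
  then show ?thesis using 2 by blast
qed

lemma is_rep_swap: "is_rep U V E rx ry \<Longrightarrow> is_rep U V E ry rx"
  by (auto simp: is_rep_def)

lemma rep_separates_edges:
  assumes rep: "is_rep U V E rx ry" and i: "ind_2K2 E a c b d"
  shows "before rx b d a c \<and> before ry a c b d \<or> before ry b d a c \<and> before rx a c b d"
proof -
  obtain u1 v1 u2 v2 where u: "indep_edges U V E u1 v1 u2 v2" "{u1, v1} = {a, c}" "{u2, v2} = {b, d}"
    "ind_2K2 E u1 v1 u2 v2" using ind_2K2_indep_edges[OF i] by blast
  have m: "u1 \<in> U" "v1 \<in> V" "u2 \<in> U" "v2 \<in> V" using u(1) by (auto simp: indep_edges_def)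
  have "\<not> E u1 v2" using u(1) by (auto simp: indep_edges_def)
  then have "\<not> (lessr rx u1 v2 \<and> lessr ry u1 v2)" using rep m by (auto simp: is_rep_def)
  \<comment> \<open>The non-edge \<open>u1 v2\<close> is reversed in one of the orders, and this
    decides the position of both edges in both orders.\<close>
  then have "lessr rx v2 u1 \<or> lessr ry v2 u1"
    using rep m disj lessr_total[of "U \<union> V" _ u1 v2] unfolding is_rep_def by blast
  then have "before rx u2 v2 u1 v1 \<and> before ry u1 v1 u2 v2 \<or> before ry u2 v2 u1 v1 \<and> before rx u1 v1 u2 v2"
    using rep_separates_edges_left[OF rep m u(4)] rep_separates_edges_left[OF is_rep_swap[OF rep] m u(4)]
    by blast
  then show ?thesis using u(2,3) unfolding before_def doubleton_eq_iff by blast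
qed

lemma inc_rep:
  assumes "is_rep U V E rx ry" "inc E a b"
  shows "lessr ry a b \<longleftrightarrow> lessr rx b a" "lessr rx a b \<longleftrightarrow> \<not> lessr rx b a"
    "lessr ry a b \<longleftrightarrow> \<not> lessr ry b a"
proof -
  have *: "linear_order_on (U \<union> V) rx" "linear_order_on (U \<union> V) ry"
    using assms by (auto simp: is_rep_def)
  show "lessr ry a b \<longleftrightarrow> lessr rx b a" "lessr rx a b \<longleftrightarrow> \<not> lessr rx b a"
    "lessr ry a b \<longleftrightarrow> \<not> lessr ry b a"
    using rep_separates_edges[OF assms(1)] assms(2) lessr_asym[OF *(1)] lessr_asym[OF *(2)]
    unfolding inc_def before_def by metis+
qed

lemma forces_rep:
  assumes rep: "is_rep U V E rx ry" and "forces E a b p q"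
  shows "lessr rx a b \<longleftrightarrow> lessr rx p q"
  using assms(2)
proof (induction rule: forces.induct)
  case (left p q c d)
  have "linear_order_on (U \<union> V) rx" using rep by (auto simp: is_rep_def)
  then have "lessr rx p q \<longleftrightarrow> lessr rx c q"
    using rep_separates_edges[OF rep left.hyps(2)] lessr_asym unfolding before_def by metis
  then show ?case using left.IH by simp
next
  case (right p q c d)
  have "linear_order_on (U \<union> V) rx" using rep by (auto simp: is_rep_def)
  then have "lessr rx p q \<longleftrightarrow> lessr rx p d"
    using rep_separates_edges[OF rep right.hyps(2)] lessr_asym unfolding before_def by metis
  then show ?case using right.IH by simp
qed simp

text \<open>A pair forcing its own reversal could not be oriented by any representation. In this
  form representability enters the analysis of components and buried subgraphs.\<close>

lemma not_forces_swap:
  assumes "is_rep U V E rx ry"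
  shows "\<not> forces E a b b a"
  using forces_rep[OF assms] inc_rep[OF assms] forces_inc by blast

lemma rep_linear: "is_rep U V E rx ry \<Longrightarrow> linear_order_on (U \<union> V) rx \<and> linear_order_on (U \<union> V) ry"
  by (auto simp: is_rep_def)

end

section \<open>Normalizing a representation\<close>

definition refine :: "'a set \<Rightarrow> 'a set \<Rightarrow> ('a \<Rightarrow> 'a \<Rightarrow> bool) \<Rightarrow> ('a \<times> 'a) set \<Rightarrow> ('a \<times> 'a) set" where
  "refine U V E r = {(x, y). x \<in> U \<union> V \<and> y \<in> U \<union> V \<and>
     (x = y \<or> prec U V E x y \<or> inc E x y \<and> lessr r x y)}"

lemma lessr_refine:
  "lessr (refine U V E r) x y \<longleftrightarrow> x \<in> U \<union> V \<and> y \<in> U \<union> V \<and> x \<noteq> y \<and>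
    (prec U V E x y \<or> inc E x y \<and> lessr r x y)"
  by (auto simp: lessr_def refine_def)

context twin_free_bigraph
begin

lemma linear_refine:
  assumes rep: "is_rep U V E rx ry"
  shows "linear_order_on (U \<union> V) (refine U V E rx)"
proof -
  have lin: "linear_order_on (U \<union> V) rx" using rep rep_linear by blast
  \<comment> \<open>The two pairs through \<open>a\<close> are in one forcing class, so
    \<open>rx\<close> puts \<open>a\<close> on the same side of both.\<close>
  have same: "lessr rx a b \<longleftrightarrow> lessr rx a c" if "inc E a b" "inc E a c" "\<not> inc E b c" for a b c
    using forces_rep[OF rep forces_if_not_inc[OF that]] .
  have same': "lessr rx b a \<longleftrightarrow> lessr rx c a" if "inc E a b" "inc E a c" "\<not> inc E b c" for a b c
    using same[OF that] inc_rep(2)[OF rep] that by blast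
  have asym: "x = y" if "(x, y) \<in> refine U V E rx" "(y, x) \<in> refine U V E rx" for x y
    using that prec_asym[of x y] prec_not_inc[of x y] prec_not_inc[of y x] inc_sym[of x y]
      lessr_asym[OF lin, of x y]
    by (auto simp: refine_def)
  have trans: "(x, z) \<in> refine U V E rx"
    if xy: "(x, y) \<in> refine U V E rx" and yz: "(y, z) \<in> refine U V E rx" for x y z
  proof -
    have m: "x \<in> U \<union> V" "y \<in> U \<union> V" "z \<in> U \<union> V" using that by (auto simp: refine_def)
    let ?P = "prec U V E"
    \<comment> \<open>Transitivity can fail only on a cyclic triple. Two sides in
      \<open>prec\<close> compose and contradict the third side, exactly one contradicts
      \<open>same\<close> or \<open>same'\<close>, and none contradicts transitivity of
      \<open>rx\<close>.\<close>
    have "x = y \<or> y = z \<or> x = z \<or> ?P x z \<or> inc E x z \<and> lessr rx x z"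
    proof (rule ccontr)
      assume n: "\<not> ?thesis"
      then have xz: "?P z x \<or> inc E x z \<and> lessr rx z x"
        using prec_trichotomy[OF m(1,3)] lessr_total[OF lin m(1,3)] by blast
      from n xy yz have 1: "?P x y \<or> inc E x y \<and> lessr rx x y" "?P y z \<or> inc E y z \<and> lessr rx y z"
        by (auto simp: refine_def)
      show False
      proof (cases "?P x y")
        case True
        then have yz: "inc E y z" "lessr rx y z" using 1 n prec_trans by blast+
        then have "\<not> ?P z x" using True prec_trans prec_not_inc inc_sym by blast
        then have "inc E x z" "lessr rx z x" using xz by blast+
        then show False
          using same[of z x y] yz inc_sym True prec_not_inc lessr_asym[OF lin] by blast
      next
        case False
        then have xy: "inc E x y" "lessr rx x y" using 1 by blast+
        show False
        proof (cases "?P y z")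
          case True
          then have "\<not> ?P z x" using xy prec_trans prec_not_inc inc_sym by blast
          then have "inc E x z" "lessr rx z x" using xz by blast+
          then show False
            using same'[of x y z] xy inc_sym True prec_not_inc lessr_asym[OF lin] by blast
        next
          case False
          then have yz: "inc E y z" "lessr rx y z" using 1 by blast+
          then have l: "lessr rx x z" using lessr_trans[OF lin] xy by blast
          then have "?P z x" using xz lessr_asym[OF lin] by blast
          then show False
            using same'[of y z x] xy yz inc_sym prec_not_inc lessr_asym[OF lin] by blast
        qed
      qed
    qed
    then show ?thesis using that m by (auto simp: refine_def)
  qed
  have total: "(x, y) \<in> refine U V E rx \<or> (y, x) \<in> refine U V E rx"
    if "x \<in> U \<union> V" "y \<in> U \<union> V" for x y
    using prec_trichotomy[OF that] lessr_total[OF lin that] inc_sym[of x y] that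
    unfolding refine_def by blast
  show ?thesis
    unfolding linear_order_on_iff
  proof (intro conjI allI impI ballI)
    show "refine U V E rx \<subseteq> (U \<union> V) \<times> (U \<union> V)" by (auto simp: refine_def)
    show "(x, x) \<in> refine U V E rx" if "x \<in> U \<union> V" for x using that by (simp add: refine_def)
  qed (fact trans asym total)+
qed

text \<open>A representation orders incomparable vertices oppositely, so the refined orders agree
  only on \<open>prec\<close>.\<close>

lemma normalized_refine:
  assumes rep: "is_rep U V E rx ry"
  shows "normalized_rep U V E (refine U V E rx) (refine U V E ry)"
  unfolding normalized_rep_iff
proof (intro conjI ballI)
  show "linear_order_on (U \<union> V) (refine U V E rx)" using linear_refine rep .
  show "linear_order_on (U \<union> V) (refine U V E ry)" using linear_refine is_rep_swap[OF rep] .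
  fix x y assume "x \<in> U \<union> V" "y \<in> U \<union> V"
  then show "(lessr (refine U V E rx) x y \<and> lessr (refine U V E ry) x y) = prec U V E x y"
    using inc_rep[OF rep, of x y] prec_irrefl[of x] unfolding lessr_refine by blast
qed

lemma normalized_swap: "normalized_rep U V E rx ry \<Longrightarrow> normalized_rep U V E ry rx"
  unfolding normalized_rep_iff by (simp add: conj_commute)

lemma normalized_is_rep: "normalized_rep U V E rx ry \<Longrightarrow> is_rep U V E rx ry"
  by (auto simp: normalized_rep_def)

text \<open>A normalized order extends \<open>prec\<close>, which leaves it a choice only on
  incomparable pairs.\<close>

lemma normalized_fst_eq:
  assumes n: "normalized_rep U V E rx ry" "normalized_rep U V E sx sy"
    and eq: "\<And>a b. inc E a b \<Longrightarrow> lessr rx a b \<longleftrightarrow> lessr sx a b"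
  shows "rx = sx"
proof -
  have sub: "rx \<subseteq> sx" if n: "normalized_rep U V E rx ry" "normalized_rep U V E sx sy"
    and eq: "\<And>a b. inc E a b \<Longrightarrow> lessr rx a b \<longleftrightarrow> lessr sx a b" for rx ry sx sy
  proof safe
    fix x y assume xy: "(x, y) \<in> rx"
    have lin: "linear_order_on (U \<union> V) rx" "linear_order_on (U \<union> V) sx"
      using n by (auto simp: normalized_rep_iff)
    have m: "x \<in> U \<union> V" "y \<in> U \<union> V" using xy lin(1) by (auto simp: linear_order_on_iff)
    show "(x, y) \<in> sx"
    proof (cases "x = y")
      case True then show ?thesis using lin(2) m by (auto simp: linear_order_on_iff)
    next
      case False
      then have l: "lessr rx x y" using xy by (simp add: lessr_def)
      then have "\<not> prec U V E y x" using n(1) m lessr_asym[OF lin(1)] by (auto simp: normalized_rep_iff)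
      then have "prec U V E x y \<or> inc E x y" using prec_trichotomy[OF m] False by blast
      then have "lessr sx x y" using n(2) m eq l unfolding normalized_rep_iff by blast
      then show ?thesis by (simp add: lessr_def)
    qed
  qed
  show ?thesis using sub[OF n eq] sub[OF n(2,1)] eq by blast
qed

lemma normalized_eq:
  assumes n: "normalized_rep U V E rx ry" "normalized_rep U V E sx sy"
    and eq: "\<And>a b. inc E a b \<Longrightarrow> lessr rx a b \<longleftrightarrow> lessr sx a b"
  shows "rx = sx \<and> ry = sy"
proof
  show "rx = sx" using normalized_fst_eq[OF n eq] .
  have "lessr ry a b \<longleftrightarrow> lessr sy a b" if "inc E a b" for a b
    using inc_rep[OF normalized_is_rep[OF n(1)] that] inc_rep[OF normalized_is_rep[OF n(2)] that]
      eq[OF that] by blast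
  then show "ry = sy" using normalized_fst_eq normalized_swap n by blast
qed

text \<open>The orientation of \<open>a b\<close> fixes that of every incomparable pair, and its two
  choices are realized by a normalized representation and its exchange.\<close>

lemma unique_if_linked:
  assumes rep: "is_rep U V E rx ry" and ab: "inc E a b"
    and all: "\<And>p q. inc E p q \<Longrightarrow> linked a b p q"
  shows "uniquely_representable U V E"
proof -
  define sx sy where "sx = refine U V E rx" and "sy = refine U V E ry"
  have s: "normalized_rep U V E sx sy" "normalized_rep U V E sy sx"
    using normalized_refine[OF rep] normalized_swap by (auto simp: sx_def sy_def)
  have ne: "sx \<noteq> sy" using inc_rep[OF normalized_is_rep[OF s(1)] ab] by auto
  have "(tx = sx \<and> ty = sy) \<or> (tx = sy \<and> ty = sx)" if t: "normalized_rep U V E tx ty" for tx ty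
  proof -
    have agree: "tx = zx \<and> ty = zy"
      if z: "normalized_rep U V E zx zy" and l: "lessr tx a b \<longleftrightarrow> lessr zx a b" for zx zy
    proof (rule normalized_eq[OF t z])
      fix p q assume pq: "inc E p q"
      note tr = normalized_is_rep[OF t] and zr = normalized_is_rep[OF z]
      show "lessr tx p q \<longleftrightarrow> lessr zx p q"
        using all[OF pq] l forces_rep[OF tr, of a b] forces_rep[OF zr, of a b]
          inc_rep(2)[OF tr pq] inc_rep(2)[OF zr pq] unfolding linked_def by blast
    qed
    have "lessr sy a b \<longleftrightarrow> \<not> lessr sx a b"
      using inc_rep[OF normalized_is_rep[OF s(1)] ab] by blast
    then show ?thesis using agree[OF s(1)] agree[OF s(2)] by blast
  qed
  then have "{(rx, ry). normalized_rep U V E rx ry} = {(sx, sy), (sy, sx)}"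
    using s by auto
  then show ?thesis using ne by (simp add: uniquely_representable_def)
qed

section \<open>Components of the auxiliary graph as forcing classes\<close>

lemma plus_edges_iff:
  "((a, b), (c, d)) \<in> plus_edges U V E \<longleftrightarrow> (a \<in> U \<longleftrightarrow> b \<notin> U) \<and> ind_2K2 E a c b d"
proof
  assume l: "((a, b), (c, d)) \<in> plus_edges U V E"
  then have e: "E a c" "E b d" "a \<in> U \<longleftrightarrow> b \<notin> U" "\<not> E a b" "\<not> E c d"
    using disj by (auto simp: plus_edges_def plus_verts_def plus_adj_def)
  \<comment> \<open>The remaining non-adjacencies \<open>a d\<close> and \<open>c b\<close> hold
    because these pairs lie inside a part.\<close>
  then show "(a \<in> U \<longleftrightarrow> b \<notin> U) \<and> ind_2K2 E a c b d"
    using E_side[of a c] E_side[of b d] E_side[of a d] E_side[of c b] by (auto simp: ind_2K2_def)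
next
  assume r: "(a \<in> U \<longleftrightarrow> b \<notin> U) \<and> ind_2K2 E a c b d"
  then have "E a c" "E b d" by (auto simp: ind_2K2_def)
  then show "((a, b), (c, d)) \<in> plus_edges U V E"
    using r E_mem[of a c] E_mem[of b d] E_side[of a c] E_side[of b d]
    by (auto simp: plus_edges_def plus_verts_def plus_adj_def ind_2K2_def)
qed

text \<open>An edge of the auxiliary graph moves both vertices of a pair at once, which amounts to
  two forcing moves.\<close>

lemma forces_if_plus_path:
  assumes "(x, y) \<in> (plus_edges U V E)\<^sup>*" "inc E (fst x) (snd x)"
  shows "forces E (fst x) (snd x) (fst y) (snd y)"
  using assms(1)
proof (induction rule: rtrancl_induct)
  case base then show ?case using assms(2) forces.refl by metis
next
  case (step y z)
  then have "ind_2K2 E (fst y) (fst z) (snd y) (snd z)"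
    using plus_edges_iff[of "fst y" "snd y" "fst z" "snd z"] by simp
  then have "forces E (fst y) (snd y) (fst z) (snd z)" by (rule ind_2K2_forces)
  then show ?case using step.IH forces_trans by metis
qed

text \<open>A forcing chain may pass through pairs in a common part, which are no vertices of the auxiliary
  graph; the else-branch is the invariant that carries the induction across them.\<close>
lemma plus_path_if_forces:
  assumes f: "forces E a b p q" and ab: "a \<in> U \<longleftrightarrow> b \<notin> U"
  shows "if p \<in> U \<longleftrightarrow> q \<notin> U then ((a, b), (p, q)) \<in> (plus_edges U V E)\<^sup>*
    else (\<forall>d. E q d \<longrightarrow> \<not> E p d \<longrightarrow> ((a, b), (p, d)) \<in> (plus_edges U V E)\<^sup>*) \<and>
      (\<forall>c. E p c \<longrightarrow> \<not> E c q \<longrightarrow> ((a, b), (c, q)) \<in> (plus_edges U V E)\<^sup>*)"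
  using f
proof (induction rule: forces.induct)
  case refl then show ?case using ab by simp
next
  case (left p q c d)
  have i: "E p c" "E q d" "\<not> E p q" "\<not> E p d" "\<not> E c q" "\<not> E c d"
    using left.hyps by (auto simp: ind_2K2_def)
  note side = E_side[OF i(1)] E_side[OF i(2)]
  show ?case
  proof (cases "p \<in> U \<longleftrightarrow> q \<notin> U")
    case True
    have pq: "((a, b), (p, q)) \<in> (plus_edges U V E)\<^sup>*" using left.IH True by argo
    \<comment> \<open>The move leads to \<open>c q\<close> inside one part. Replacing
      \<open>q\<close> by \<open>d'\<close> next completes a single edge from \<open>(p, q)\<close>
      to \<open>(c, d')\<close>.\<close>
    have "((a, b), (c, d')) \<in> (plus_edges U V E)\<^sup>*" if d': "E q d'" "\<not> E c d'" for d'
    proof -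
      have "ind_2K2 E p c q d'"
        using i d' side True E_side[of q d'] E_side[of p d'] by (auto simp: ind_2K2_def)
      then show ?thesis using pq True plus_edges_iff rtrancl_into_rtrancl by metis
    qed
    \<comment> \<open>Replacing \<open>c\<close> by \<open>c'\<close> keeps \<open>q\<close>, so the
      path takes a detour through \<open>(c, d)\<close>.\<close>
    moreover have "((a, b), (c', q)) \<in> (plus_edges U V E)\<^sup>*" if c': "E c c'" "\<not> E c' q" for c'
    proof -
      have "ind_2K2 E c c' d q"
        using i c' side True E_side[of c c'] E_side[of c' d] E_sym[of q d] by (auto simp: ind_2K2_def)
      moreover have "((a, b), (c, d)) \<in> (plus_edges U V E)\<^sup>*"
        using pq True plus_edges_iff left.hyps rtrancl_into_rtrancl by metis
      moreover have "c \<in> U \<longleftrightarrow> d \<notin> U" using side True by blast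
      ultimately show ?thesis using plus_edges_iff rtrancl_into_rtrancl by metis
    qed
    moreover have "\<not> (c \<in> U \<longleftrightarrow> q \<notin> U)" using side True by blast
    ultimately show ?thesis by simp
  next
    case False
    then have "((a, b), (c, q)) \<in> (plus_edges U V E)\<^sup>*" using left.IH i by metis
    then show ?thesis using side False by simp
  qed
next
  case (right p q c d)
  have i: "E p c" "E q d" "\<not> E p q" "\<not> E p d" "\<not> E c q" "\<not> E c d"
    using right.hyps by (auto simp: ind_2K2_def)
  note side = E_side[OF i(1)] E_side[OF i(2)]
  show ?case
  proof (cases "p \<in> U \<longleftrightarrow> q \<notin> U")
    case True
    have pq: "((a, b), (p, q)) \<in> (plus_edges U V E)\<^sup>*" using right.IH True by argo
    have "((a, b), (c', d)) \<in> (plus_edges U V E)\<^sup>*" if c': "E p c'" "\<not> E c' d" for c'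
    proof -
      have "ind_2K2 E p c' q d"
        using i c' side True E_side[of p c'] E_side[of c' q] by (auto simp: ind_2K2_def)
      then show ?thesis using pq True plus_edges_iff rtrancl_into_rtrancl by metis
    qed
    moreover have "((a, b), (p, d')) \<in> (plus_edges U V E)\<^sup>*" if d': "E d d'" "\<not> E p d'" for d'
    proof -
      have "ind_2K2 E c p d d'"
        using i d' side True E_side[of d d'] E_side[of c d'] E_sym[of p c] by (auto simp: ind_2K2_def)
      moreover have "((a, b), (c, d)) \<in> (plus_edges U V E)\<^sup>*"
        using pq True plus_edges_iff right.hyps rtrancl_into_rtrancl by metis
      moreover have "c \<in> U \<longleftrightarrow> d \<notin> U" using side True by blast
      ultimately show ?thesis using plus_edges_iff rtrancl_into_rtrancl by metis
    qed
    moreover have "\<not> (p \<in> U \<longleftrightarrow> d \<notin> U)" using side True by blast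
    ultimately show ?thesis by simp
  next
    case False
    then have "((a, b), (p, d)) \<in> (plus_edges U V E)\<^sup>*" using right.IH i by metis
    then show ?thesis using side False by simp
  qed
qed

definition plus_class :: "'a \<Rightarrow> 'a \<Rightarrow> ('a \<times> 'a) set" where
  "plus_class a b = {(c, d). forces E a b c d \<and> (c \<in> U \<longleftrightarrow> d \<notin> U)}"

lemma plus_component_eq:
  assumes i: "inc E a b" and ab: "a \<in> U \<longleftrightarrow> b \<notin> U"
  shows "plus_component U V E (a, b) = plus_class a b"
proof (intro set_eqI iffI)
  fix x assume x: "x \<in> plus_component U V E (a, b)"
  then have "forces E a b (fst x) (snd x)"
    using forces_if_plus_path[of "(a, b)" x] i by (simp add: plus_component_def)
  then show "x \<in> plus_class a b"
    using x disj by (auto simp: plus_component_def plus_verts_def plus_class_def)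
next
  fix x assume "x \<in> plus_class a b"
  then obtain c d where x: "x = (c, d)" "forces E a b c d" "c \<in> U \<longleftrightarrow> d \<notin> U" by (auto simp: plus_class_def)
  have "((a, b), (c, d)) \<in> (plus_edges U V E)\<^sup>*" using plus_path_if_forces[OF x(2) ab] x(3) by simp
  moreover have "(c, d) \<in> plus_verts U V E"
    using forces_inc[OF x(2)] inc_mem[of c d] E_not_inc[of c d] x(3) by (auto simp: plus_verts_def)
  ultimately show "x \<in> plus_component U V E (a, b)" by (simp add: x(1) plus_component_def)
qed

lemma nontrivial_plus_components_eq:
  "nontrivial_plus_components U V E = {plus_class a b | a b. inc E a b \<and> (a \<in> U \<longleftrightarrow> b \<notin> U)}"
proof (intro set_eqI iffI)
  fix C assume "C \<in> nontrivial_plus_components U V E"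
  then obtain p x y where p: "p \<in> plus_verts U V E" "C = plus_component U V E p"
    and x: "x \<in> C" and xy: "(x, y) \<in> plus_edges U V E"
    by (auto simp: nontrivial_plus_components_def)
  have "(p, x) \<in> (plus_edges U V E)\<^sup>*" using x p by (auto simp: plus_component_def)
  \<comment> \<open>The path from \<open>p\<close> to \<open>x\<close>, prolonged by the edge to
    \<open>y\<close>, is nonempty; its first edge leaves \<open>p\<close> itself.\<close>
  then obtain z where z: "(p, z) \<in> plus_edges U V E"
    using xy by (metis converse_rtranclE)
  obtain a b where ab: "p = (a, b)" by (cases p)
  have "ind_2K2 E a (fst z) b (snd z)" "a \<in> U \<longleftrightarrow> b \<notin> U"
    using z ab plus_edges_iff[of a b "fst z" "snd z"] by auto
  then have "inc E a b" "C = plus_class a b" using ind_2K2_inc plus_component_eq p(2) ab by metis+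
  with \<open>a \<in> U \<longleftrightarrow> b \<notin> U\<close> show "C \<in> {plus_class a b | a b. inc E a b \<and> (a \<in> U \<longleftrightarrow> b \<notin> U)}"
    by blast
next
  fix C assume "C \<in> {plus_class a b | a b. inc E a b \<and> (a \<in> U \<longleftrightarrow> b \<notin> U)}"
  then obtain a b where ab: "C = plus_class a b" "inc E a b" "a \<in> U \<longleftrightarrow> b \<notin> U" by blast
  then obtain c d where i: "ind_2K2 E a c b d" by (auto simp: inc_def)
  have C: "C = plus_component U V E (a, b)" using plus_component_eq ab by simp
  have e: "((a, b), (c, d)) \<in> plus_edges U V E" using plus_edges_iff i ab(3) by blast
  then have "(a, b) \<in> plus_verts U V E" "(c, d) \<in> plus_verts U V E" by (auto simp: plus_edges_def)
  moreover from this have "(a, b) \<in> C" "(c, d) \<in> C" using e by (auto simp: C plus_component_def)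
  ultimately show "C \<in> nontrivial_plus_components U V E"
    using e C unfolding nontrivial_plus_components_def by blast
qed

text \<open>The classes of \<open>a b\<close> and \<open>b a\<close> are two distinct components, as
  no pair forces its reversal. A further one exists exactly if some incomparable pair is not linked
  to \<open>a b\<close>.\<close>

lemma two_plus_components_iff:
  assumes rep: "is_rep U V E rx ry" and ab: "inc E a b" "a \<in> U \<longleftrightarrow> b \<notin> U"
  shows "card (nontrivial_plus_components U V E) = 2 \<longleftrightarrow> (\<forall>p q. inc E p q \<longrightarrow> linked a b p q)"
proof -
  have ba: "inc E b a" using ab inc_sym by blast
  have in_plus_class: "(c, d) \<in> plus_class c d" if "inc E c d" "c \<in> U \<longleftrightarrow> d \<notin> U" for c d
    using that forces.refl[OF that(1)] by (auto simp: plus_class_def)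
  have ne: "plus_class a b \<noteq> plus_class b a"
    using in_plus_class[OF ab] not_forces_swap[OF rep, of b a] by (auto simp: plus_class_def)
  then have two: "card {plus_class a b, plus_class b a} = 2" by simp
  have sub: "{plus_class a b, plus_class b a} \<subseteq> nontrivial_plus_components U V E"
    unfolding nontrivial_plus_components_eq using ab ba by blast
  show ?thesis
  proof
    assume c: "card (nontrivial_plus_components U V E) = 2"
    then have "finite (nontrivial_plus_components U V E)" by (metis card.infinite zero_neq_numeral)
    then have eq: "{plus_class a b, plus_class b a} = nontrivial_plus_components U V E"
      using sub two c by (metis card_subset_eq)
    show "\<forall>p q. inc E p q \<longrightarrow> linked a b p q"
    proof (intro allI impI)
      fix p q assume "inc E p q"
      then obtain r s where i: "ind_2K2 E p r q s" by (auto simp: inc_def)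
      \<comment> \<open>One of \<open>q\<close> and \<open>s\<close> lies in the part opposite to
        \<open>p\<close>; taking it instead of \<open>q\<close> stays in the class and gives a
        vertex of the auxiliary graph.\<close>
      obtain q' where q': "forces E p q p q'" "p \<in> U \<longleftrightarrow> q' \<notin> U"
        using ind_2K2_forces[OF i] i E_side[of q s] unfolding ind_2K2_def by blast
      then have "plus_class p q' \<in> nontrivial_plus_components U V E" "(p, q') \<in> plus_class p q'"
        using forces_inc in_plus_class unfolding nontrivial_plus_components_eq by blast+
      then have "(p, q') \<in> plus_class a b \<or> (p, q') \<in> plus_class b a" using eq by blast
      then have "linked a b p q'" using linked_swap by (auto simp: plus_class_def linked_def)
      moreover have "linked p q' p q" using q' forces_sym by (auto simp: linked_def)
      ultimately show "linked a b p q" by (rule linked_trans)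
    qed
  next
    assume l: "\<forall>p q. inc E p q \<longrightarrow> linked a b p q"
    have "plus_class p q \<in> {plus_class a b, plus_class b a}" if "inc E p q" for p q
    proof -
      have eq: "plus_class p q = plus_class x y" if "forces E x y p q" for x y
        using forces_trans[OF _ that] forces_trans[OF _ forces_sym[OF that]] by (auto simp: plus_class_def)
      have "forces E a b p q \<or> forces E b a p q"
        using l that forces_swap unfolding linked_def by blast
      then show ?thesis using eq by blast
    qed
    then have "nontrivial_plus_components U V E \<subseteq> {plus_class a b, plus_class b a}"
      unfolding nontrivial_plus_components_eq by blast
    then show "card (nontrivial_plus_components U V E) = 2" using sub two by auto
  qed
qed

section \<open>Spans of forcing classes as buried subgraphs\<close>

lemma span_mem: "linked a b x y \<Longrightarrow> x \<in> span a b \<and> y \<in> span a b"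
  using linked_swap unfolding span_def by blast

lemma spanD:
  assumes "x \<in> span a b"
  obtains y c d where "inc E x y" "ind_2K2 E x c y d" "{c, y, d} \<subseteq> span a b"
proof -
  obtain y where l: "linked a b x y" using assms by (auto simp: span_def)
  then obtain c d where i: "ind_2K2 E x c y d" using linked_inc[OF l] unfolding inc_def by blast
  have "linked x y c d" using ind_2K2_forces[OF i] by (simp add: linked_def)
  then have "linked a b c d" using l linked_trans by blast
  then show thesis using that[OF _ i] l span_mem ind_2K2_inc[OF i] by blast
qed

text \<open>By \<open>span_module\<close>, \<open>x\<close> is comparable to the whole span. Its
  direction cannot flip along a linked pair \<open>r s\<close>, since \<open>x\<close> between
  \<open>r\<close> and \<open>s\<close> would make these comparable.\<close>

lemma span_prec_const:
  assumes x: "x \<in> U \<union> V" "x \<notin> span a b" and p: "p \<in> span a b" and q: "q \<in> span a b"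
    and ni: "\<not> inc E x p"
  shows "prec U V E x p \<longleftrightarrow> prec U V E x q" "prec U V E p x \<longleftrightarrow> prec U V E q x"
proof -
  have ni: "\<not> inc E x r" if "r \<in> span a b" for r using ni span_module[OF x(2) that p] by blast
  have step: "prec U V E x s" if l: "linked a b r s" and r: "prec U V E x r" for r s
  proof -
    have m: "r \<in> span a b" "s \<in> span a b" "inc E r s" using span_mem l linked_inc by blast+
    then have "s \<noteq> x" "s \<in> U \<union> V" "\<not> prec U V E s r" using x inc_mem prec_not_inc inc_sym by blast+
    then show ?thesis using prec_trichotomy[of x s] x ni[OF m(2)] prec_trans r by blast
  qed
  have step': "prec U V E s x" if l: "linked a b r s" and r: "prec U V E r x" for r s
  proof -
    have m: "r \<in> span a b" "s \<in> span a b" "inc E r s" using span_mem l linked_inc by blast+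
    then have "s \<noteq> x" "s \<in> U \<union> V" "\<not> prec U V E r s" using x inc_mem prec_not_inc by blast+
    then show ?thesis using prec_trichotomy[of x s] x ni[OF m(2)] prec_trans r by blast
  qed
  show "prec U V E x p \<longleftrightarrow> prec U V E x q"
    using span_connected[of a b "prec U V E x", OF _ p q] step linked_swap by blast
  show "prec U V E p x \<longleftrightarrow> prec U V E q x"
    using span_connected[of a b "\<lambda>r. prec U V E r x", OF _ p q] step' linked_swap by blast
qed

lemma buried_span:
  assumes ab: "inc E a b" and x0: "x0 \<notin> span a b" "inc E x0 y0"
  shows "buried U V E (span a b)"
proof -
  let ?B = "span a b"
  have sub: "?B \<subseteq> U \<union> V" using linked_inc inc_mem unfolding span_def by blast
  have A: "\<exists>u1 v1 u2 v2. u1 \<in> ?B \<and> v1 \<in> ?B \<and> u2 \<in> ?B \<and> v2 \<in> ?B \<and> indep_edges U V E u1 v1 u2 v2"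
  proof -
    have a: "a \<in> ?B" using linked_refl[OF ab] span_mem by blast
    obtain y c d where i: "ind_2K2 E a c y d" "{c, y, d} \<subseteq> ?B" by (rule spanD[OF a])
    obtain u1 v1 u2 v2 where u: "indep_edges U V E u1 v1 u2 v2"
      "{u1, v1} = {a, c}" "{u2, v2} = {y, d}" by (rule ind_2K2_indep_edges[OF i(1)])
    have "{u1, v1} \<subseteq> ?B" "{u2, v2} \<subseteq> ?B" using u a i(2) by auto
    then have "u1 \<in> ?B" "v1 \<in> ?B" "u2 \<in> ?B" "v2 \<in> ?B" by simp_all
    then show ?thesis using u(1) by metis
  qed
  \<comment> \<open>Adjacency of \<open>u\<close> to a vertex of \<open>V\<close> is a
    \<open>prec\<close> relation and hence constant on the span.\<close>
  have B1: "?B \<inter> V \<subseteq> nbhd E u \<or> ?B \<inter> V \<inter> nbhd E u = {}" if u: "u \<in> U - ?B" for u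
  proof (rule ccontr)
    assume "\<not> ?thesis"
    then obtain p q where pq: "p \<in> ?B" "p \<in> V" "q \<in> ?B" "q \<in> V" "E u p" "\<not> E u q"
      by (auto simp: nbhd_def)
    then show False
      using span_prec_const(1)[of u a b p q] u E_not_inc[of u p] by auto
  qed
  have B2: "?B \<inter> U \<subseteq> nbhd E v \<or> ?B \<inter> U \<inter> nbhd E v = {}" if v: "v \<in> V - ?B" for v
  proof (rule ccontr)
    assume "\<not> ?thesis"
    then obtain p q where pq: "p \<in> ?B" "p \<in> U" "q \<in> ?B" "q \<in> U" "E v p" "\<not> E v q"
      by (auto simp: nbhd_def)
    then show False
      using span_prec_const(2)[of v a b p q] v E_not_inc[of v p] E_sym[of v p] E_sym[of v q] by auto
  qed
  have C: "\<exists>u1 v1 u2 v2. u1 \<notin> ?B \<and> v1 \<notin> ?B \<and>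
      (indep_edges U V E u1 v1 u2 v2 \<or> indep_edges U V E u2 v2 u1 v1)"
  proof -
    obtain c d where i: "ind_2K2 E x0 c y0 d" using x0 by (auto simp: inc_def)
    then have e: "E x0 c" "E y0 d" by (auto simp: ind_2K2_def)
    have "\<exists>x c y d. ind_2K2 E x c y d \<and> x \<notin> ?B \<and> c \<notin> ?B"
    proof (cases "c \<in> ?B")
      case True
      \<comment> \<open>The edge \<open>y0 d\<close> replaces \<open>x0 c\<close>. As a neighbour of
        \<open>c\<close>, \<open>x0\<close> is incomparable to nothing in the span, so
        \<open>y0\<close> lies outside; and \<open>y0\<close> is incomparable to \<open>c\<close>,
        hence to the whole span, which therefore misses its neighbour \<open>d\<close>.\<close>
      have n: "\<not> inc E x0 r" if "r \<in> ?B" for r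
        using span_module[OF x0(1) that True] E_not_inc[OF e(1)] by blast
      have y: "y0 \<notin> ?B" using n x0 by blast
      have "inc E y0 c" using ind_2K2_inc ind_2K2_sym i by metis
      then have "inc E y0 r" if "r \<in> ?B" for r using span_module[OF y True that] by blast
      then have "d \<notin> ?B" using E_not_inc[OF e(2)] by blast
      then show ?thesis using y ind_2K2_sym(1)[OF i] by blast
    next
      case False
      then show ?thesis using x0 i by blast
    qed
    then obtain x c y d where i: "ind_2K2 E x c y d" "x \<notin> ?B" "c \<notin> ?B" by blast
    obtain u1 v1 u2 v2 where u: "indep_edges U V E u1 v1 u2 v2" "{u1, v1} = {x, c}"
      by (rule ind_2K2_indep_edges[OF i(1)])
    have "{u1, v1} \<inter> ?B = {}" using u(2) i by auto
    then have "u1 \<notin> ?B" "v1 \<notin> ?B" by simp_all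
    then show ?thesis using u(1) by metis
  qed
  have D: "nbhd E x \<inter> ?B \<noteq> {} \<and> \<not> ?B \<inter> V \<subseteq> nbhd E x" if x: "x \<in> ?B \<inter> U" for x
  proof -
    have "x \<in> ?B" using x by blast
    then obtain y c d where i: "ind_2K2 E x c y d" "{c, y, d} \<subseteq> ?B" by (rule spanD)
    then have e: "E x c" "E y d" "\<not> E x y" "\<not> E x d" by (auto simp: ind_2K2_def)
    have "y \<in> V \<or> d \<in> V" using e(2) E_mem E_side by blast
    then show ?thesis using e i(2) by (auto simp: nbhd_def)
  qed
  have D': "nbhd E x \<inter> ?B \<noteq> {} \<and> \<not> ?B \<inter> U \<subseteq> nbhd E x" if x: "x \<in> ?B \<inter> V" for x
  proof -
    have "x \<in> ?B" using x by blast
    then obtain y c d where i: "ind_2K2 E x c y d" "{c, y, d} \<subseteq> ?B" by (rule spanD)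
    then have e: "E x c" "E y d" "\<not> E x y" "\<not> E x d" by (auto simp: ind_2K2_def)
    have "y \<in> U \<or> d \<in> U" using e(2) E_mem E_side by blast
    then show ?thesis using e i(2) by (auto simp: nbhd_def)
  qed
  show ?thesis
    unfolding buried_def using sub A C by (intro conjI ballI B1 B2) (use D D' in simp_all)
qed

text \<open>By the triangle argument some span misses a vertex that is incomparable to another one;
  that span is buried.\<close>

lemma buried_if_not_linked:
  assumes "inc E a b" "inc E p q" "\<not> linked a b p q"
  shows "\<exists>B. buried U V E B"
  using linked_if_same_span[OF _ assms(1,2)] assms(3) buried_span by blast

section \<open>Buried subgraphs as modules of the canonical order\<close>

lemma buriedE:
  assumes "buried U V E B"
  obtains u1 v1 u2 v2 where "u1 \<in> B" "v1 \<in> B" "u2 \<in> B" "v2 \<in> B" "indep_edges U V E u1 v1 u2 v2"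
  using assms[unfolded buried_def] by (elim conjE exE) (rule that)

lemma buried_outside_inc:
  assumes "buried U V E B"
  obtains e f where "inc E e f" "e \<notin> B"
proof -
  obtain p q p' q' where "p \<notin> B" "indep_edges U V E p q p' q' \<or> indep_edges U V E p' q' p q"
    using assms[unfolded buried_def] by (elim conjE exE) (rule that)
  then show thesis using that indep_edges_ind_2K2 ind_2K2_inc inc_sym by metis
qed

lemma buriedD:
  assumes "buried U V E B"
  shows "B \<subseteq> U \<union> V"
    "u \<in> U \<Longrightarrow> u \<notin> B \<Longrightarrow> B \<inter> V \<subseteq> nbhd E u \<or> B \<inter> V \<inter> nbhd E u = {}"
    "v \<in> V \<Longrightarrow> v \<notin> B \<Longrightarrow> B \<inter> U \<subseteq> nbhd E v \<or> B \<inter> U \<inter> nbhd E v = {}"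
    "x \<in> B \<Longrightarrow> \<exists>y \<in> B. E x y"
    "x \<in> B \<Longrightarrow> x \<in> U \<Longrightarrow> \<exists>y \<in> B \<inter> V. \<not> E x y"
    "x \<in> B \<Longrightarrow> x \<in> V \<Longrightarrow> \<exists>y \<in> B \<inter> U. \<not> E x y"
proof -
  show sub: "B \<subseteq> U \<union> V" using assms by (simp add: buried_def)
  show "u \<in> U \<Longrightarrow> u \<notin> B \<Longrightarrow> B \<inter> V \<subseteq> nbhd E u \<or> B \<inter> V \<inter> nbhd E u = {}"
    "v \<in> V \<Longrightarrow> v \<notin> B \<Longrightarrow> B \<inter> U \<subseteq> nbhd E v \<or> B \<inter> U \<inter> nbhd E v = {}"
    using assms by (simp_all add: buried_def)
  have d: "\<forall>x \<in> B \<inter> U. nbhd E x \<inter> B \<noteq> {} \<and> \<not> (B \<inter> V \<subseteq> nbhd E x)"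
    "\<forall>x \<in> B \<inter> V. nbhd E x \<inter> B \<noteq> {} \<and> \<not> (B \<inter> U \<subseteq> nbhd E x)"
    using assms by (simp_all add: buried_def)
  show "x \<in> B \<Longrightarrow> \<exists>y \<in> B. E x y" using d sub unfolding nbhd_def by blast
  show "x \<in> B \<Longrightarrow> x \<in> U \<Longrightarrow> \<exists>y \<in> B \<inter> V. \<not> E x y"
    "x \<in> B \<Longrightarrow> x \<in> V \<Longrightarrow> \<exists>y \<in> B \<inter> U. \<not> E x y"
    using d unfolding nbhd_def by blast+
qed

text \<open>For independent edges \<open>u1 v1\<close>, \<open>u2 v2\<close> in \<open>B\<close>, a
  non-edge \<open>u v\<close> would force both \<open>v1 u2\<close> and \<open>v2 u1\<close>. As
  \<open>v1 u2\<close> forces \<open>u1 v2\<close>, a class would contain a pair and its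
  reversal.\<close>

lemma buried_full_adjacent:
  assumes nf: "\<And>a b. \<not> forces E a b b a" and B: "buried U V E B"
    and u: "u \<in> U - B" "B \<inter> V \<subseteq> nbhd E u" and v: "v \<in> V - B" "B \<inter> U \<subseteq> nbhd E v"
  shows "E u v"
proof (rule ccontr)
  assume n: "\<not> E u v"
  obtain u1 v1 u2 v2 where m: "u1 \<in> B" "v1 \<in> B" "u2 \<in> B" "v2 \<in> B" "indep_edges U V E u1 v1 u2 v2"
    by (rule buriedE[OF B])
  from m have i: "ind_2K2 E u1 v1 u2 v2" using indep_edges_ind_2K2 by blast
  have s: "u1 \<in> U" "u2 \<in> U" "v1 \<in> V" "v2 \<in> V" using m by (auto simp: indep_edges_def)
  have e: "E u v1" "E u v2" "E v u1" "E v u2" using u v m s by (auto simp: nbhd_def)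
  have ne: "\<not> E u u1" "\<not> E u u2" "\<not> E v1 v" "\<not> E v2 v"
    using u v s E_side[of u u1] E_side[of u u2] E_side'[of v1 v] E_side'[of v2 v] by auto
  have "ind_2K2 E u v1 v u2" "ind_2K2 E u v2 v u1"
    using e ne n i E_sym[of u2 v1] E_sym[of u1 v2] by (auto simp: ind_2K2_def)
  then have f: "forces E u v v1 u2" "forces E u v v2 u1" using ind_2K2_forces by blast+
  have "forces E v1 u2 u1 v2" using ind_2K2_forces(4)[of v1 u1 u2 v2] ind_2K2_sym(2)[OF i] by blast
  then have "forces E v2 u1 u1 v2" using f forces_trans forces_sym by meson
  then show False using nf by blast
qed

text \<open>If \<open>u\<close> is adjacent to all of \<open>B \<inter> V\<close>, it precedes all
  of \<open>B\<close>. Otherwise it is adjacent to none of it: \<open>u\<close> follows all of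
  \<open>B\<close> if each neighbour of \<open>u\<close> is adjacent to all of
  \<open>B \<inter> U\<close>, and is unrelated to all of \<open>B\<close> if some neighbour is
  not.\<close>

lemma buried_module_left:
  assumes nf: "\<And>a b. \<not> forces E a b b a" and B: "buried U V E B"
    and u: "u \<in> U - B" and b: "b \<in> B" "b' \<in> B"
  shows "(prec U V E u b \<longleftrightarrow> prec U V E u b') \<and> (prec U V E b u \<longleftrightarrow> prec U V E b' u)"
proof -
  note sub = buriedD(1)[OF B] and fu = buriedD(2)[OF B] and fv = buriedD(3)[OF B]
  note adj = buried_full_adjacent[OF nf B]
  have inV: "z \<in> V" if "E x z" "x \<in> U" for x z using that E_mem[of x z] E_side[of x z] by blast
  have inU: "z \<in> U" if "E x z" "x \<in> V" for x z using that E_mem[of x z] E_side'[of x z] by blast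
  have nb: "\<exists>y. E r y \<and> y \<in> B \<inter> V" if "r \<in> B" "r \<in> U" for r
    using buriedD(4)[OF B that(1)] inV that(2) by blast
  have nb': "\<exists>y. E r y \<and> y \<in> B \<inter> U" if "r \<in> B" "r \<in> V" for r
    using buriedD(4)[OF B that(1)] inU that(2) by blast
  show ?thesis
  proof (cases "B \<inter> V \<subseteq> nbhd E u")
    case full: True
    have "prec U V E u r" if r: "r \<in> B" for r
    proof (cases "r \<in> V")
      case True
      then show ?thesis using full r u by (auto simp: nbhd_def)
    next
      case False
      then have rU: "r \<in> U" using r sub by blast
      have "E u z" if z: "E r z" for z
      proof (cases "z \<in> B")
        case True then show ?thesis using full inV[OF z rU] by (auto simp: nbhd_def)
      next
        case False
        have "r \<in> B \<inter> U \<inter> nbhd E z" using r rU z E_sym[of r z] by (auto simp: nbhd_def)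
        then have "B \<inter> U \<subseteq> nbhd E z" using fv[of z] inV[OF z rU] False by blast
        then show ?thesis using adj[OF u full] inV[OF z rU] False by blast
      qed
      \<comment> \<open>The inclusion is strict because \<open>r\<close> is not universal in
        \<open>B\<close>.\<close>
      moreover obtain y where "\<not> E r y" "y \<in> B \<inter> V" using buriedD(5)[OF B r rU] by blast
      ultimately have "nbhd E r \<subset> nbhd E u" using full by (auto simp: nbhd_def)
      then show ?thesis using rU u by simp
    qed
    then show ?thesis using b prec_asym by blast
  next
    case False
    then have none: "B \<inter> V \<inter> nbhd E u = {}" using fu u by blast
    have zB: "z \<in> V - B" if "E u z" for z using none inV[OF that] u that by (auto simp: nbhd_def)
    show ?thesis
    proof (cases "\<forall>z. E u z \<longrightarrow> B \<inter> U \<subseteq> nbhd E z")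
      case True
      have "prec U V E r u" if r: "r \<in> B" for r
      proof (cases "r \<in> U")
        case rU: True
        have "E r z" if "E u z" for z
        proof -
          have "r \<in> nbhd E z" using True that r rU by blast
          then show ?thesis using E_sym[of r z] by (simp add: nbhd_def)
        qed
        moreover obtain y where "E r y" "y \<in> B \<inter> V" using nb[OF r rU] by blast
        ultimately have "nbhd E u \<subset> nbhd E r" using none by (auto simp: nbhd_def)
        then show ?thesis using rU u by simp
      next
        case False
        then have rV: "r \<in> V" using r sub by blast
        have "E x y" if x: "E r x" and y: "E u y" for x y
        proof (cases "x \<in> B")
          case True
          then have "x \<in> nbhd E y" using \<open>\<forall>z. _\<close> y inU[OF x rV] by blast
          then show ?thesis using E_sym[of x y] by (simp add: nbhd_def)
        next
          case False
          have "r \<in> B \<inter> V \<inter> nbhd E x" using r rV x E_sym[of r x] by (auto simp: nbhd_def)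
          then have "B \<inter> V \<subseteq> nbhd E x" using fu[of x] inU[OF x rV] False by blast
          then show ?thesis using adj[of x y] zB[OF y] \<open>\<forall>z. _\<close> y inU[OF x rV] False by blast
        qed
        moreover have "\<not> E u r" using none r rV by (auto simp: nbhd_def)
        ultimately show ?thesis using rV u by simp
      qed
      then show ?thesis using b prec_asym by blast
    next
      case False
      then obtain z where z: "E u z" "\<not> B \<inter> U \<subseteq> nbhd E z" by blast
      then have zn: "\<not> E z r" if "r \<in> B \<inter> U" for r
        using fv[of z] zB[OF z(1)] z(2) that by (auto simp: nbhd_def)
      have "\<not> prec U V E u r \<and> \<not> prec U V E r u" if r: "r \<in> B" for r
      proof (cases "r \<in> U")
        case rU: True
        have "z \<in> nbhd E u" "z \<notin> nbhd E r" using z(1) zn[of r] r rU E_sym[of r z] by (auto simp: nbhd_def)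
        moreover obtain y where "E r y" "y \<in> B \<inter> V" using nb[OF r rU] by blast
        then have "y \<in> nbhd E r" "y \<notin> nbhd E u" using none by (auto simp: nbhd_def)
        ultimately show ?thesis using rU u by auto
      next
        case False
        then have rV: "r \<in> V" using r sub by blast
        obtain x where x: "E r x" "x \<in> B \<inter> U" using nb'[OF r rV] by blast
        then have "\<not> E x z" using zn[of x] E_sym[of x z] by blast
        moreover have "\<not> E u r" using none r rV by (auto simp: nbhd_def)
        ultimately show ?thesis using x z(1) rV u by auto
      qed
      then show ?thesis using b by blast
    qed
  qed
qed

lemma buried_dual:
  assumes "buried U V E B"
  shows "buried V U E B"
proof -
  have i: "indep_edges V U E v1 u1 v2 u2" if "indep_edges U V E u1 v1 u2 v2" for u1 v1 u2 v2
    using that E_sym by (simp add: indep_edges_def)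
  obtain u1 v1 u2 v2 where a: "u1 \<in> B" "v1 \<in> B" "u2 \<in> B" "v2 \<in> B" "indep_edges U V E u1 v1 u2 v2"
    by (rule buriedE[OF assms])
  obtain p q p' q' where c: "p \<notin> B" "q \<notin> B"
    "indep_edges U V E p q p' q' \<or> indep_edges U V E p' q' p q"
    using assms[unfolded buried_def] by (elim conjE exE) (rule that)
  show ?thesis
    using assms a(1-4) i[OF a(5)] c i unfolding buried_def[of V U] buried_def[of U V]
    by (intro conjI; (elim conjE; (assumption | simp add: Un_commute))?; metis)
qed

lemma buried_module:
  assumes nf: "\<And>a b. \<not> forces E a b b a" and B: "buried U V E B"
    and x: "x \<in> U \<union> V" "x \<notin> B" and b: "b \<in> B" "b' \<in> B"
  shows "(prec U V E x b \<longleftrightarrow> prec U V E x b') \<and> (prec U V E b x \<longleftrightarrow> prec U V E b' x)"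
proof (cases "x \<in> U")
  case True
  then show ?thesis using buried_module_left[OF nf B _ b] x by blast
next
  case False
  then have "x \<in> V - B" using x by blast
  then show ?thesis
    using twin_free_bigraph.buried_module_left[OF dual nf buried_dual[OF B] _ b, of x]
    by (simp add: prec_dual)
qed

end

section \<open>Replacing the internal order of a buried subgraph\<close>

text \<open>The set \<open>B\<close> is moved as a block to the position of \<open>b0\<close> in \<open>r\<close> and ordered internally by \<open>s\<close>.\<close>
definition graft :: "'a set \<Rightarrow> 'a \<Rightarrow> ('a \<times> 'a) set \<Rightarrow> ('a \<times> 'a) set \<Rightarrow> ('a \<times> 'a) set" where
  "graft B b0 r s = {(x, y). (if x \<in> B \<and> y \<in> B then (x, y) \<in> s
     else (if x \<in> B then b0 else x, if y \<in> B then b0 else y) \<in> r)}"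

lemma linear_graft:
  assumes r: "linear_order_on A r" and s: "linear_order_on A s" and B: "b0 \<in> B" "B \<subseteq> A"
  shows "linear_order_on A (graft B b0 r s)"
proof -
  have b0: "b0 \<in> A" using B by blast
  have r1: "\<And>x y. (x, y) \<in> r \<Longrightarrow> x \<in> A \<and> y \<in> A" "\<And>x. x \<in> A \<Longrightarrow> (x, x) \<in> r"
    "\<And>x y z. (x, y) \<in> r \<Longrightarrow> (y, z) \<in> r \<Longrightarrow> (x, z) \<in> r"
    "\<And>x y. (x, y) \<in> r \<Longrightarrow> (y, x) \<in> r \<Longrightarrow> x = y"
    "\<And>x y. x \<in> A \<Longrightarrow> y \<in> A \<Longrightarrow> (x, y) \<in> r \<or> (y, x) \<in> r"
    using r unfolding linear_order_on_iff by auto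
  have s1: "\<And>x y. (x, y) \<in> s \<Longrightarrow> x \<in> A \<and> y \<in> A" "\<And>x. x \<in> A \<Longrightarrow> (x, x) \<in> s"
    "\<And>x y z. (x, y) \<in> s \<Longrightarrow> (y, z) \<in> s \<Longrightarrow> (x, z) \<in> s"
    "\<And>x y. (x, y) \<in> s \<Longrightarrow> (y, x) \<in> s \<Longrightarrow> x = y"
    "\<And>x y. x \<in> A \<Longrightarrow> y \<in> A \<Longrightarrow> (x, y) \<in> s \<or> (y, x) \<in> s"
    using s unfolding linear_order_on_iff by auto
  \<comment> \<open>A chain cannot leave the block \<open>B\<close> and return to it; this settles
    the cases of transitivity and antisymmetry that neither \<open>r\<close> nor \<open>s\<close>
    gives directly.\<close>
  have cut: "(y, b0) \<notin> r" if "y \<notin> B" "(b0, y) \<in> r" for y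
    using that r1(4) B by blast
  show ?thesis
    unfolding linear_order_on_iff
  proof (intro conjI ballI allI impI)
    show "graft B b0 r s \<subseteq> A \<times> A"
      using r1(1) s1(1) B by (auto simp: graft_def split: if_splits)
    show "(x, x) \<in> graft B b0 r s" if "x \<in> A" for x
      using that r1(2) s1(2) by (simp add: graft_def)
    show "(x, z) \<in> graft B b0 r s" if "(x, y) \<in> graft B b0 r s" "(y, z) \<in> graft B b0 r s" for x y z
      using that r1(3) s1(3) cut by (auto simp: graft_def split: if_splits)
    show "x = y" if "(x, y) \<in> graft B b0 r s" "(y, x) \<in> graft B b0 r s" for x y
      using that r1(4) s1(4) cut by (auto simp: graft_def split: if_splits)
    show "(x, y) \<in> graft B b0 r s \<or> (y, x) \<in> graft B b0 r s" if "x \<in> A" "y \<in> A" for x y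
      using that r1(5) s1(5) b0 by (simp add: graft_def)
  qed
qed

lemma lessr_graft:
  assumes "b0 \<in> B"
  shows "lessr (graft B b0 r s) x y \<longleftrightarrow> (if x \<in> B \<and> y \<in> B then lessr s x y
     else lessr r (if x \<in> B then b0 else x) (if y \<in> B then b0 else y))"
  using assms by (auto simp: graft_def lessr_def)

context twin_free_bigraph
begin

text \<open>Since \<open>B\<close> is a module, \<open>b0\<close> can stand for every vertex of
  \<open>B\<close> when compared with the outside; inside \<open>B\<close> only \<open>sx\<close>
  and \<open>sy\<close> count.\<close>

lemma normalized_graft:
  assumes nf: "\<And>a b. \<not> forces E a b b a" and B: "buried U V E B" "b0 \<in> B"
    and r: "normalized_rep U V E rx ry" and s: "normalized_rep U V E sx sy"
  shows "normalized_rep U V E (graft B b0 rx sx) (graft B b0 ry sy)"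
  unfolding normalized_rep_iff
proof (intro conjI ballI)
  have sub: "B \<subseteq> U \<union> V" using B by (simp add: buried_def)
  show "linear_order_on (U \<union> V) (graft B b0 rx sx)" "linear_order_on (U \<union> V) (graft B b0 ry sy)"
    using r s B sub by (auto simp: normalized_rep_iff intro: linear_graft)
  fix x y assume m: "x \<in> U \<union> V" "y \<in> U \<union> V"
  let ?f = "\<lambda>x. if x \<in> B then b0 else x"
  show "(lessr (graft B b0 rx sx) x y \<and> lessr (graft B b0 ry sy) x y) = prec U V E x y"
  proof (cases "x \<in> B \<and> y \<in> B")
    case True
    then show ?thesis using s m B by (simp add: lessr_graft normalized_rep_iff)
  next
    case False
    have "?f x \<in> U \<union> V" "?f y \<in> U \<union> V" using m B sub by auto
    then have "lessr rx (?f x) (?f y) \<and> lessr ry (?f x) (?f y) \<longleftrightarrow> prec U V E (?f x) (?f y)"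
      using r unfolding normalized_rep_iff by blast
    also have "\<dots> \<longleftrightarrow> prec U V E x y"
      using False buried_module[OF nf B(1) m(1), of y b0] buried_module[OF nf B(1) m(2), of x b0] B(2)
      by auto
    finally show ?thesis using False B by (simp only: lessr_graft if_False)
  qed
qed

lemma not_unique_if_buried:
  assumes rep: "is_rep U V E rx ry" and B: "buried U V E B"
  shows "\<not> uniquely_representable U V E"
proof
  assume u: "uniquely_representable U V E"
  define sx sy where "sx = refine U V E rx" and "sy = refine U V E ry"
  have s: "normalized_rep U V E sx sy" "normalized_rep U V E sy sx"
    using normalized_refine[OF rep] normalized_swap by (auto simp: sx_def sy_def)
  have nf: "\<not> forces E a b b a" for a b using not_forces_swap[OF rep] .
  obtain u1 v1 u2 v2 where m: "u1 \<in> B" "v1 \<in> B" "u2 \<in> B" "v2 \<in> B" "indep_edges U V E u1 v1 u2 v2"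
    by (rule buriedE[OF B])
  then have inc1: "inc E u1 u2" using indep_edges_ind_2K2 ind_2K2_inc by metis
  obtain e f where e: "inc E e f" "e \<notin> B" by (rule buried_outside_inc[OF B])
  let ?g = "graft B u1"
  \<comment> \<open>\<open>R1\<close> makes \<open>B\<close> a block, \<open>R2\<close> then
    exchanges the orders inside the block only, and \<open>R3\<close> exchanges them
    everywhere.\<close>
  define R1 where "R1 = (?g sx sx, ?g sy sy)"
  define R2 where "R2 = (?g sx sy, ?g sy sx)"
  define R3 where "R3 = (?g sy sy, ?g sx sx)"
  let ?S = "{(rx, ry). normalized_rep U V E rx ry}"
  have n1: "normalized_rep U V E (?g sx sx) (?g sy sy)" using normalized_graft[OF nf B m(1) s(1) s(1)] .
  have sub: "{R1, R2, R3} \<subseteq> ?S"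
    using n1 normalized_graft[OF nf B m(1) s(1) s(2)] normalized_graft[OF nf B m(1) s(2) s(2)]
    by (simp add: R1_def R2_def R3_def)
  have "lessr sx u1 u2 \<noteq> lessr sy u1 u2"
    using inc_rep[OF normalized_is_rep[OF s(1)] inc1] by blast
  then have "?g sx sx \<noteq> ?g sx sy" "?g sx sx \<noteq> ?g sy sy"
    using lessr_graft[OF m(1), of _ _ u1 u2] m by metis+
  \<comment> \<open>Since \<open>e\<close> is outside \<open>B\<close>, the inner order does not
    affect \<open>e f\<close>; so \<open>?g sx sx\<close> and \<open>?g sy sy\<close> would agree on
    this incomparable pair.\<close>
  moreover have "?g sx sy \<noteq> ?g sy sy"
  proof
    assume "?g sx sy = ?g sy sy"
    then have "lessr (?g sx sy) e f = lessr (?g sy sy) e f" by simp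
    then have "lessr (?g sx sx) e f = lessr (?g sy sy) e f"
      using e by (simp add: lessr_graft[OF m(1)])
    then show False using inc_rep[OF normalized_is_rep[OF n1] e(1)] by blast
  qed
  ultimately have "card {R1, R2, R3} = 3" by (simp add: R1_def R2_def R3_def)
  moreover have c: "card ?S = 2" using u by (simp add: uniquely_representable_def)
  then have "finite ?S" by (metis card.infinite zero_neq_numeral)
  then have "card {R1, R2, R3} \<le> 2" using card_mono[OF _ sub] c by simp
  ultimately show False by simp
qed

end

theorem theorem3:
  fixes U V :: "'a set" and E :: "'a \<Rightarrow> 'a \<Rightarrow> bool"
  assumes "bip_graph U V E"
    and "connected_graph U V E"
    and "tdorg U V E"
    and "twin_free U V E"
    and "\<exists>u1 v1 u2 v2. indep_edges U V E u1 v1 u2 v2"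
  shows "(uniquely_representable U V E \<longleftrightarrow> \<not> (\<exists>B. buried U V E B))
       \<and> (\<not> (\<exists>B. buried U V E B) \<longleftrightarrow> card (nontrivial_plus_components U V E) = 2)"
proof -
  interpret twin_free_bigraph U V E by unfold_locales (use assms in auto)
  obtain rx ry where rep: "is_rep U V E rx ry" using assms(3) by (auto simp: tdorg_def)
  obtain u1 v1 u2 v2 where i: "indep_edges U V E u1 v1 u2 v2" using assms(5) by blast
  \<comment> \<open>The pair \<open>u1 v2\<close> is taken as base because it lies in opposite parts
    and so is a vertex of the auxiliary graph.\<close>
  have inc: "inc E u1 v2"
    using ind_2K2_forces(3)[OF indep_edges_ind_2K2[OF i]] forces_inc by blast
  have side: "u1 \<in> U \<longleftrightarrow> v2 \<notin> U" using i disj by (auto simp: indep_edges_def)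
  note comps = two_plus_components_iff[OF rep inc side]
  \<comment> \<open>All conditions are compared with the one that every incomparable pair is linked
    to \<open>u1 v2\<close>: it gives uniqueness, uniqueness excludes buried subgraphs, and their
    absence gives it back.\<close>
  show ?thesis
    using comps unique_if_linked[OF rep inc] not_unique_if_buried[OF rep] buried_if_not_linked[OF inc]
    by blast
qed

end
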